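(* Let $m>0$. For every $\varepsilon>0$ there exists $\psi\in\mathcal{H}_+$ with $\|\psi\|=1$, $\int_{\mathbb{R}^3}|\boldsymbol{x}|^2|\psi(\boldsymbol{x})|^2\,d^3\boldsymbol{x}<\infty$ and $\sigma_\psi<\varepsilon$. Equivalently, there is a sequence $\psi_n\in\mathcal{H}_+$ with $\|\psi_n\|=1$ and $\sigma_{\psi_n}\to 0$ as $n\to\infty$.
   Context: Let $\mathcal{H}=L^2(\mathbb{R}^3,\mathbb{C}^4)$ and let $\alpha_1,\alpha_2,\alpha_3,\beta$ be Hermitian $4\times 4$ Dirac matrices, i.e. $\alpha_j\alpha_k+\alpha_k\alpha_j=2\delta_{jk}\mathbb{1}$, $\alpha_j\beta+\beta\alpha_j=0$, $\beta^2=\mathbb{1}$. The free Dirac Hamiltonian (units $\hbar=c=1$, mass $m>0$) is the self-adjoint operator $H_D=-i\boldsymbol{\alpha}\cdot\nabla+\beta m$ on $\mathcal{H}$ with domain $H^1(\mathbb{R}^3,\mathbb{C}^4)$; its spectrum is $(-\infty,-m]\cup[m,\infty)$. $\mathcal{H}_+$ is the positive-energy subspace, i.e. the spectral subspace of $H_D$ for $[m,\infty)$; equivalently, $\psi\in\mathcal{H}_+$ iff for a.e. $\boldsymbol{p}$ the Fourier transform $\widehat\psi(\boldsymbol p)$ is an eigenvector (or zero) of the matrix $\boldsymbol{\alpha}\cdot\boldsymbol{p}+\beta m$ with eigenvalue $E(\boldsymbol p)=\sqrt{\boldsymbol p^2+m^2}$. For $\psi\in\mathcal{H}$ with $\|\psi\|=1$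 and finite second moment, the position uncertainty $\sigma_\psi\ge 0$ is defined by $\sigma_\psi^2=\int d^3\boldsymbol{x}\,\boldsymbol{x}^2|\psi(\boldsymbol{x})|^2-\big|\int d^3\boldsymbol{x}\,\boldsymbol{x}|\psi(\boldsymbol{x})|^2\big|^2$, where $|\psi(\boldsymbol x)|^2=\psi(\boldsymbol x)^\dagger\psi(\boldsymbol x)$. *)

theory Defs
  imports "HOL-Analysis.Analysis"
begin

definition hermitian4 :: "complex^4^4 \<Rightarrow> bool" where
  "hermitian4 A \<longleftrightarrow> (\<forall>i j. A $ i $ j = cnj (A $ j $ i))"

definition dirac_matrices :: "(3 \<Rightarrow> complex^4^4) \<Rightarrow> complex^4^4 \<Rightarrow> bool" where
  "dirac_matrices \<alpha> \<beta> \<longleftrightarrow>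
     (\<forall>j. hermitian4 (\<alpha> j)) \<and> hermitian4 \<beta> \<and>
     (\<forall>j k. \<alpha> j ** \<alpha> k + \<alpha> k ** \<alpha> j = (if j = k then 2 else 0) *\<^sub>R mat 1) \<and>
     (\<forall>j. \<alpha> j ** \<beta> + \<beta> ** \<alpha> j = 0) \<and>
     \<beta> ** \<beta> = mat 1"

definition L2 :: "(real^3 \<Rightarrow> complex^4) \<Rightarrow> bool" where
  "L2 \<psi> \<longleftrightarrow> \<psi> \<in> borel_measurable lborel \<and> integrable lborel (\<lambda>x. (norm (\<psi> x))\<^sup>2)"

definition L2norm_sq :: "(real^3 \<Rightarrow> complex^4) \<Rightarrow> real" where
  "L2norm_sq \<psi> = integral\<^sup>L lborel (\<lambda>x. (norm (\<psi> x))\<^sup>2)"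

definition fourier3 :: "(real^3 \<Rightarrow> complex) \<Rightarrow> real^3 \<Rightarrow> complex" where
  "fourier3 g x = complex_of_real ((2 * pi) powr (-3/2)) *
     integral\<^sup>L lborel (\<lambda>p. exp (- \<i> * complex_of_real (x \<bullet> p)) * g p)"

text \<open>phi is the (Plancherel, L^2) Fourier transform of psi in L^2: phi is in L^2 and,
  componentwise, the multiplication formula  \<integral> phi g = \<integral> psi (F g)  holds for every
  continuous compactly supported test function g. This determines phi uniquely a.e.
  and coincides with the unitary L^2 Fourier transform.\<close>
definition is_fourier_L2 :: "(real^3 \<Rightarrow> complex^4) \<Rightarrow> (real^3 \<Rightarrow> complex^4) \<Rightarrow> bool" where
  "is_fourier_L2 \<psi> \<phi> \<longleftrightarrow> L2 \<psi> \<and> L2 \<phi> \<and>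
     (\<forall>g :: real^3 \<Rightarrow> complex. continuous_on UNIV g \<longrightarrow> bounded {p. g p \<noteq> 0} \<longrightarrow>
        (\<forall>k. integral\<^sup>L lborel (\<lambda>p. \<phi> p $ k * g p) =
             integral\<^sup>L lborel (\<lambda>x. \<psi> x $ k * fourier3 g x)))"

definition dirac_symbol :: "(3 \<Rightarrow> complex^4^4) \<Rightarrow> complex^4^4 \<Rightarrow> real \<Rightarrow> real^3 \<Rightarrow> complex^4^4" where
  "dirac_symbol \<alpha> \<beta> m p = (\<Sum>j\<in>UNIV. (p $ j) *\<^sub>R \<alpha> j) + m *\<^sub>R \<beta>"

definition Hplus :: "(3 \<Rightarrow> complex^4^4) \<Rightarrow> complex^4^4 \<Rightarrow> real \<Rightarrow> (real^3 \<Rightarrow> complex^4) set" where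
  "Hplus \<alpha> \<beta> m = {\<psi>. \<exists>\<phi>. is_fourier_L2 \<psi> \<phi> \<and>
     (AE p in lborel. dirac_symbol \<alpha> \<beta> m p *v \<phi> p =
        complex_of_real (sqrt ((norm p)\<^sup>2 + m\<^sup>2)) *s \<phi> p)}"

definition finite_second_moment :: "(real^3 \<Rightarrow> complex^4) \<Rightarrow> bool" where
  "finite_second_moment \<psi> \<longleftrightarrow> integrable lborel (\<lambda>x. (norm x)\<^sup>2 * (norm (\<psi> x))\<^sup>2)"

definition pos_uncertainty :: "(real^3 \<Rightarrow> complex^4) \<Rightarrow> real" where
  "pos_uncertainty \<psi> = sqrt (integral\<^sup>L lborel (\<lambda>x. (norm x)\<^sup>2 * (norm (\<psi> x))\<^sup>2)
      - (norm (integral\<^sup>L lborel (\<lambda>x. (norm (\<psi> x))\<^sup>2 *\<^sub>R x)))\<^sup>2)"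

end

theory Submission
  imports Defs "HOL-Probability.Probability" "HOL-Real_Asymp.Real_Asymp"
begin

text \<open>
  For \<open>H(p) = \<alpha> \<cdot> p + \<beta> m\<close> and \<open>E = sqrt (|p|\<^sup>2 + m\<^sup>2)\<close> one has \<open>H\<^sup>2 = E\<^sup>2\<close>, so
  \<open>\<phi>(p) = exp (- b |p|\<^sup>2) (1 + H(p)/E) v\<close> is a positive-energy spinor for every \<open>v\<close>. As \<open>b \<rightarrow> 0\<close> the
  position-space norm \<open>\<parallel>\<psi>\<parallel>\<^sup>2\<close> grows like \<open>b powr (-3/2)\<close>, whereas the second moment is \<open>O(1/b)\<close>; hence
  the normalised uncertainty tends to zero.

  Plancherel's theorem is avoided by writing \<open>1/E\<close> as an integral of the Gaussians
  \<open>exp (- E\<^sup>2 u\<^sup>2)\<close> over \<open>u\<close>: this exhibits \<open>\<psi>\<close> explicitly as a superposition of Gaussians in \<open>x\<close>. It is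
  integrable, so \<open>\<phi>\<close> is its ordinary Fourier transform and the multiplication formula is Fubini's
  theorem, and both estimates are made directly in position space. The lower bound on the norm comes
  from choosing the unit vector \<open>v\<close> with \<open>\<langle>v, \<beta> v\<rangle> \<ge> 0\<close>.
\<close>

section \<open>Fourier integrals\<close>

lemma abs_le_one_plus_square: "\<bar>t\<bar> \<le> 1 + t\<^sup>2" for t :: real
proof -
  have "0 \<le> (\<bar>t\<bar> - 1)\<^sup>2" "0 \<le> t\<^sup>2" by simp_all
  then show ?thesis by (simp add: power2_eq_square algebra_simps)
qed


section \<open>Integrals of products of one-variable functions\<close>

lemma lborel_prod_inner:
  fixes f :: "'a::euclidean_space \<Rightarrow> real \<Rightarrow> complex"
  assumes f: "\<And>b. b \<in> Basis \<Longrightarrow> integrable lborel (f b)"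
  shows "integrable lborel (\<lambda>x::'a. \<Prod>b\<in>Basis. f b (x \<bullet> b))"
    and "(\<integral>x. (\<Prod>b\<in>Basis. f b (x \<bullet> b)) \<partial>lborel) = (\<Prod>b\<in>Basis. integral\<^sup>L lborel (f b))"
proof -
  interpret product_sigma_finite "\<lambda>_::'a. lborel :: real measure" ..
  let ?g = "\<lambda>y::'a \<Rightarrow> real. \<Sum>b\<in>Basis. y b *\<^sub>R b"
  have [measurable]: "f b \<in> borel_measurable borel" if "b \<in> Basis" for b
    using f[OF that] by (simp add: integrable_iff_bounded)
  have g: "?g \<in> measurable (\<Pi>\<^sub>M b\<in>Basis. lborel) borel" by measurable
  have h: "(\<lambda>x::'a. \<Prod>b\<in>Basis. f b (x \<bullet> b)) \<in> borel_measurable borel" by measurable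
  have *: "?g y \<bullet> b = y b" if "b \<in> Basis" for y b
    using that by (simp add: inner_sum_left_Basis)
  have eq: "(\<lambda>y. \<Prod>b\<in>Basis. f b (?g y \<bullet> b)) = (\<lambda>y. \<Prod>b\<in>Basis. f b (y b))"
    by (auto intro!: prod.cong simp: *)
  \<comment> \<open>\<open>lborel\<close> is the image of the product of the one-dimensional
    measures under the coordinate map \<open>?g\<close>, so the finite Fubini theorem applies after
    this change of variables.\<close>
  show "integrable lborel (\<lambda>x::'a. \<Prod>b\<in>Basis. f b (x \<bullet> b))"
    unfolding lborel_eq[where 'a='a] integrable_distr_eq[OF g h] eq
    by (rule product_integrable_prod) (use f in auto)
  show "(\<integral>x. (\<Prod>b\<in>Basis. f b (x \<bullet> b)) \<partial>lborel) = (\<Prod>b\<in>Basis. integral\<^sup>L lborel (f b))"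
    unfolding lborel_eq[where 'a='a] integral_distr[OF g h] eq
    by (rule product_integral_prod) (use f in auto)
qed

lemma lborel_prod_vec:
  fixes f :: "'n::finite \<Rightarrow> real \<Rightarrow> complex"
  assumes f: "\<And>i. integrable lborel (f i)"
  shows "integrable lborel (\<lambda>x::real^'n. \<Prod>i\<in>UNIV. f i (x $ i))"
    and "(\<integral>x. (\<Prod>i\<in>UNIV. f i ((x::real^'n) $ i)) \<partial>lborel) = (\<Prod>i\<in>UNIV. integral\<^sup>L lborel (f i))"
proof -
  \<comment> \<open>The family is moved from indices to basis vectors by inverting the injection
    \<open>axis i 1\<close>, whose range is \<open>Basis\<close>.\<close>
  define F where "F b = f (the_inv (\<lambda>i. axis i (1::real)) b)" for b :: "real^'n"
  have inj: "inj (\<lambda>i::'n. axis i (1::real))"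
    by (auto simp: inj_on_def axis_eq_axis)
  have F: "F (axis i 1) = f i" for i
    unfolding F_def by (simp add: the_inv_f_f[OF inj])
  have B: "(Basis :: (real^'n) set) = range (\<lambda>i. axis i 1)"
    by (auto simp: Basis_vec_def)
  have P: "(\<Prod>b\<in>Basis. h b) = (\<Prod>i\<in>UNIV. h (axis i 1))" for h :: "real^'n \<Rightarrow> complex"
    unfolding B by (subst prod.reindex[OF inj]) simp
  have "integrable lborel (F b)" if "b \<in> Basis" for b
    using that f by (auto simp: B F)
  from lborel_prod_inner[of F, OF this]
  show "integrable lborel (\<lambda>x::real^'n. \<Prod>i\<in>UNIV. f i (x $ i))"
    and "(\<integral>x. (\<Prod>i\<in>UNIV. f i ((x::real^'n) $ i)) \<partial>lborel) = (\<Prod>i\<in>UNIV. integral\<^sup>L lborel (f i))"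
    by (simp_all add: P F inner_axis)
qed

section \<open>Gaussian integrals on the line\<close>

lemma integral_exp_gaussian:
  fixes c p :: real
  assumes c: "c > 0"
  shows "integrable lborel (\<lambda>t. exp (- \<i> * of_real (p * t)) * of_real (exp (- c * t\<^sup>2)))"
    and "(\<integral>t. exp (- \<i> * of_real (p * t)) * of_real (exp (- c * t\<^sup>2)) \<partial>lborel)
           = of_real (sqrt (pi / c) * exp (- p\<^sup>2 / (4 * c)))"
proof -
  let ?f = "\<lambda>t. exp (- \<i> * of_real (p * t)) * complex_of_real (exp (- c * t\<^sup>2))"
  \<comment> \<open>Scaling by \<open>a\<close> turns the exponent \<open>c * t\<^sup>2\<close> into
    t^2/2, so the integral becomes the characteristic function of the standard normal law at
    \<open>- p * a\<close>.\<close>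
  define a where "a = 1 / sqrt (2 * c)"
  have a: "a > 0" "a \<noteq> 0" using c by (auto simp: a_def)
  have a2: "a\<^sup>2 = 1 / (2 * c)" using c by (simp add: a_def power_divide)
  have fa: "?f (0 + a * t) = of_real (sqrt (2 * pi)) *
      (std_normal_density t *\<^sub>R iexp ((- p * a) * t))" for t
    using c by (simp add: std_normal_density_def scaleR_conv_of_real power_mult_distrib a2 mult_ac)
  have "integrable lborel (\<lambda>t. std_normal_density t *\<^sub>R iexp ((- p * a) * t))"
    by (rule Bochner_Integration.integrable_bound[OF integrable_std_normal_moment[of 0]])
       (auto simp: normal_density_nonneg norm_mult)
  then have "integrable lborel (\<lambda>t. ?f (0 + a * t))"
    unfolding fa by (rule integrable_mult_right)
  then show "integrable lborel ?f"
    using lborel_integrable_real_affine_iff[of a ?f 0] a by simp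
  have "(\<integral>t. ?f t \<partial>lborel) = \<bar>a\<bar> *\<^sub>R (\<integral>t. ?f (0 + a * t) \<partial>lborel)"
    by (rule lborel_integral_real_affine) (use a in auto)
  also have "(\<integral>t. ?f (0 + a * t) \<partial>lborel) = of_real (sqrt (2 * pi)) *
      (\<integral>t. std_normal_density t *\<^sub>R iexp ((- p * a) * t) \<partial>lborel)"
    unfolding fa by (rule integral_mult_right_zero)
  also have "(\<integral>t. std_normal_density t *\<^sub>R iexp ((- p * a) * t) \<partial>lborel) = char std_normal_distribution (- p * a)"
    unfolding char_def by (subst integral_density) (auto simp: normal_density_nonneg)
  also have "\<dots> = of_real (exp (- p\<^sup>2 / (4 * c)))"
    by (simp add: char_std_normal_distribution power_mult_distrib a2)
  also have "\<bar>a\<bar> *\<^sub>R (complex_of_real (sqrt (2 * pi)) * complex_of_real (exp (- p\<^sup>2 / (4 * c))))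
      = of_real (sqrt (pi / c) * exp (- p\<^sup>2 / (4 * c)))"
    using c by (simp add: a_def real_sqrt_divide real_sqrt_mult scaleR_conv_of_real)
  finally show "(\<integral>t. ?f t \<partial>lborel) = of_real (sqrt (pi / c) * exp (- p\<^sup>2 / (4 * c)))" .
qed

lemma integral_gaussian_real:
  fixes c :: real
  assumes c: "c > 0"
  shows "integrable lborel (\<lambda>t. exp (- c * t\<^sup>2))"
    and "(\<integral>t. exp (- c * t\<^sup>2) \<partial>lborel) = sqrt (pi / c)"
proof -
  have "integrable lborel (\<lambda>t. complex_of_real (exp (- c * t\<^sup>2)))"
    using integral_exp_gaussian(1)[OF c, of 0] by simp
  then show "integrable lborel (\<lambda>t. exp (- c * t\<^sup>2))"
    using integrable_Re by fastforce
  have "complex_of_real (\<integral>t. exp (- c * t\<^sup>2) \<partial>lborel) = of_real (sqrt (pi / c))"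
    using integral_exp_gaussian(2)[OF c, of 0]
    by (simp flip: integral_complex_of_real)
  then show "(\<integral>t. exp (- c * t\<^sup>2) \<partial>lborel) = sqrt (pi / c)"
    using of_real_eq_iff by blast
qed

text \<open>Integration by parts. The function \<open>?f\<close> vanishes at both infinities and has
  derivative \<open>?d\<close>, so the integral of \<open>?d\<close> is 0. This is a linear relation
  between the integrals of \<open>?f\<close> and \<open>?g\<close>, which is solved for the
  latter.\<close>

lemma integral_exp_gaussian_moment:
  fixes c p :: real
  assumes c: "c > 0"
  shows "integrable lborel (\<lambda>t. exp (- \<i> * of_real (p * t)) * of_real (t * exp (- c * t\<^sup>2)))"
    and "(\<integral>t. exp (- \<i> * of_real (p * t)) * of_real (t * exp (- c * t\<^sup>2)) \<partial>lborel)
           = - \<i> * of_real (p / (2 * c) * (sqrt (pi / c) * exp (- p\<^sup>2 / (4 * c))))"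
proof -
  let ?f = "\<lambda>t. exp (- \<i> * of_real (p * t)) * complex_of_real (exp (- c * t\<^sup>2))"
  let ?g = "\<lambda>t. exp (- \<i> * of_real (p * t)) * complex_of_real (t * exp (- c * t\<^sup>2))"
  let ?d = "\<lambda>t. - \<i> * of_real p * ?f t - 2 * of_real c * ?g t"
  \<comment> \<open>Half of the Gaussian decay absorbs the factor t; the other half remains as an
    integrable majorant.\<close>
  have bound: "\<bar>t * exp (- c * t\<^sup>2)\<bar> \<le> (1 + 1 / (c/2)) * exp (- (c/2) * t\<^sup>2)" for t
  proof -
    have "\<bar>t\<bar> \<le> 1 + t\<^sup>2"
      by (rule abs_le_one_plus_square)
    moreover have "(c/2) * t\<^sup>2 \<le> exp ((c/2) * t\<^sup>2)"
      using exp_ge_add_one_self[of "(c/2) * t\<^sup>2"] by linarith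
    then have "t\<^sup>2 \<le> 1 / (c/2) * exp ((c/2) * t\<^sup>2)"
      using c by (simp add: field_simps)
    moreover have "1 \<le> exp ((c/2) * t\<^sup>2)" using c by simp
    ultimately have "\<bar>t\<bar> \<le> (1 + 1 / (c/2)) * exp ((c/2) * t\<^sup>2)"
      unfolding distrib_right mult_1_left by linarith
    then have "\<bar>t\<bar> * exp (- c * t\<^sup>2) \<le> (1 + 1 / (c/2)) * exp ((c/2) * t\<^sup>2) * exp (- c * t\<^sup>2)"
      by (rule mult_right_mono) simp
    also have "\<dots> = (1 + 1 / (c/2)) * exp (- (c/2) * t\<^sup>2)"
      by (simp add: mult_exp_exp flip: exp_add)
    finally show ?thesis by (simp add: abs_mult)
  qed
  have "integrable lborel (\<lambda>t. (1 + 1 / (c/2)) * exp (- (c/2) * t\<^sup>2))"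
    using integral_gaussian_real(1)[of "c/2"] c by simp
  then show ig: "integrable lborel ?g"
  proof (rule Bochner_Integration.integrable_bound)
    show "AE t in lborel. norm (?g t) \<le> norm ((1 + 1 / (c/2)) * exp (- (c/2) * t\<^sup>2))"
    proof (rule AE_I2)
      fix t :: real
      have "norm (?g t) = \<bar>t * exp (- c * t\<^sup>2)\<bar>"
        by (simp add: norm_mult abs_mult)
      then show "norm (?g t) \<le> norm ((1 + 1 / (c/2)) * exp (- (c/2) * t\<^sup>2))"
        using order_trans[OF bound abs_ge_self] by (metis real_norm_def)
    qed
  qed simp
  note gaussian = integral_exp_gaussian[OF c, of p]
  have id: "integrable lborel ?d"
    by (intro Bochner_Integration.integrable_diff integrable_mult_right gaussian ig)
  have lim: "(?f \<longlongrightarrow> 0) F" if "F = at_top \<or> F = at_bot" for F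
  proof (rule tendsto_norm_zero_cancel)
    have "((\<lambda>t. exp (- c * t\<^sup>2)) \<longlongrightarrow> 0) F"
      using that c by (elim disjE) (simp_all, real_asymp+)
    then show "((\<lambda>t. norm (?f t)) \<longlongrightarrow> 0) F" by (simp add: norm_mult)
  qed
  have "(LBINT t=-\<infinity>..\<infinity>. ?d t) = 0 - 0"
  proof (rule interval_integral_FTC_integrable[where F = ?f])
    show "(?f has_vector_derivative ?d t) (at t)" for t
    proof -
      \<comment> \<open>The derivative is computed for the complex extension of \<open>?f\<close>
        and then restricted to the real line.\<close>
      let ?F = "\<lambda>z::complex. exp (- \<i> * of_real p * z) * exp (- of_real c * z\<^sup>2)"
      have "(?F has_field_derivative (- \<i> * of_real p * ?F (of_real t)
          - 2 * of_real c * (exp (- \<i> * of_real p * of_real t) * (of_real t * exp (- of_real c * (of_real t)\<^sup>2)))))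
          (at (of_real t))"
        by (auto intro!: derivative_eq_intros simp: algebra_simps)
      then have "((\<lambda>t. ?F (of_real t)) has_vector_derivative (- \<i> * of_real p * ?F (of_real t)
          - 2 * of_real c * (exp (- \<i> * of_real p * of_real t) * (of_real t * exp (- of_real c * (of_real t)\<^sup>2)))))
          (at t)"
        by (rule has_vector_derivative_real_field)
      then show ?thesis
        by (simp add: mult.assoc flip: exp_of_real)
    qed
  qed (use id lim in \<open>auto simp: ereal_tendsto_simps set_integrable_def intro!: continuous_intros\<close>)
  then have "integral\<^sup>L lborel ?d = 0"
    by (simp add: interval_lebesgue_integral_def set_lebesgue_integral_def)
  then have "- \<i> * of_real p * integral\<^sup>L lborel ?f - 2 * of_real c * integral\<^sup>L lborel ?g = 0"
    using gaussian ig by (simp add: Bochner_Integration.integral_diff)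
  then show "integral\<^sup>L lborel ?g = - \<i> * of_real (p / (2 * c) * (sqrt (pi / c) * exp (- p\<^sup>2 / (4 * c))))"
    unfolding gaussian(2) using c by (simp add: field_simps)
qed

section \<open>Gaussian integrals in several variables\<close>

lemma norm_vec_power2: "(norm x)\<^sup>2 = (\<Sum>i\<in>UNIV. (x $ i)\<^sup>2)" for x :: "real^'n"
  by (simp add: norm_vec_def L2_set_def sum_nonneg)

lemma integral_exp_gaussian_vec:
  fixes p :: "real^'n" and c :: real
  assumes c: "c > 0"
  shows "integrable lborel (\<lambda>x::real^'n. exp (- \<i> * of_real (p \<bullet> x)) * of_real (exp (- c * (norm x)\<^sup>2)))"
    and "(\<integral>x. exp (- \<i> * of_real (p \<bullet> x)) * of_real (exp (- c * (norm x)\<^sup>2)) \<partial>lborel)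
           = of_real (sqrt (pi / c) ^ CARD('n) * exp (- (norm p)\<^sup>2 / (4 * c)))"
proof -
  define f where "f i t = exp (- \<i> * of_real (p $ i * t)) * complex_of_real (exp (- c * t\<^sup>2))" for i t
  note nrm = norm_vec_power2
  have P: "(\<Prod>i\<in>UNIV. f i (x $ i)) =
      exp (- \<i> * of_real (p \<bullet> x)) * of_real (exp (- c * (norm x)\<^sup>2))" for x
    unfolding f_def nrm by (simp add: prod.distrib inner_vec_def sum_distrib_left exp_sum flip: sum_negf)
  have fi: "integrable lborel (f i)" for i
    unfolding f_def by (rule integral_exp_gaussian(1)[OF c])
  have If: "integral\<^sup>L lborel (f i) = of_real (sqrt (pi / c) * exp (- (p $ i)\<^sup>2 / (4 * c)))" for i
    unfolding f_def by (rule integral_exp_gaussian(2)[OF c])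
  show "integrable lborel (\<lambda>x::real^'n. exp (- \<i> * of_real (p \<bullet> x)) * of_real (exp (- c * (norm x)\<^sup>2)))"
    using lborel_prod_vec(1)[of f, OF fi] by (simp only: P)
  have "(\<integral>x. exp (- \<i> * of_real (p \<bullet> x)) * of_real (exp (- c * (norm x)\<^sup>2)) \<partial>lborel)
      = (\<Prod>i\<in>UNIV. complex_of_real (sqrt (pi / c) * exp (- (p $ i)\<^sup>2 / (4 * c))))"
    using lborel_prod_vec(2)[of f, OF fi] unfolding P If .
  also have "\<dots> = of_real (sqrt (pi / c) ^ CARD('n) * exp (- (norm p)\<^sup>2 / (4 * c)))"
    unfolding nrm by (simp add: prod.distrib exp_sum sum_divide_distrib flip: sum_negf of_real_prod)
  finally show "(\<integral>x. exp (- \<i> * of_real (p \<bullet> x)) * of_real (exp (- c * (norm x)\<^sup>2)) \<partial>lborel)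
           = of_real (sqrt (pi / c) ^ CARD('n) * exp (- (norm p)\<^sup>2 / (4 * c)))" .
qed

lemma integral_exp_gaussian_moment_vec:
  fixes p :: "real^'n" and c :: real
  assumes c: "c > 0"
  shows "integrable lborel (\<lambda>x::real^'n. exp (- \<i> * of_real (p \<bullet> x)) * of_real (x $ k * exp (- c * (norm x)\<^sup>2)))"
    and "(\<integral>x. exp (- \<i> * of_real (p \<bullet> x)) * of_real (x $ k * exp (- c * (norm x)\<^sup>2)) \<partial>lborel)
           = - \<i> * of_real (p $ k / (2 * c) * (sqrt (pi / c) ^ CARD('n) * exp (- (norm p)\<^sup>2 / (4 * c))))"
proof -
  \<comment> \<open>Only the factor with index \<open>k\<close> carries the moment; all other
    factors are plain Gaussian integrals.\<close>
  define f where "f i t = exp (- \<i> * of_real (p $ i * t)) *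
    complex_of_real ((if i = k then t else 1) * exp (- c * t\<^sup>2))" for i t
  note nrm = norm_vec_power2
  have P: "(\<Prod>i\<in>UNIV. f i (x $ i)) =
      exp (- \<i> * of_real (p \<bullet> x)) * of_real (x $ k * exp (- c * (norm x)\<^sup>2))" for x
    unfolding f_def nrm
    by (simp add: prod.distrib prod.delta inner_vec_def sum_distrib_left exp_sum if_distrib[of complex_of_real]
          flip: sum_negf cong: if_cong)
  have fi: "integrable lborel (f i)" for i
    using integral_exp_gaussian(1)[OF c] integral_exp_gaussian_moment(1)[OF c]
    by (cases "i = k") (simp_all add: f_def[abs_def])
  have If: "integral\<^sup>L lborel (f i) = (if i = k then - \<i> * of_real (p $ k / (2 * c)) else 1) *
      complex_of_real (sqrt (pi / c) * exp (- (p $ i)\<^sup>2 / (4 * c)))" for i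
    using integral_exp_gaussian(2)[OF c, of "p $ i"] integral_exp_gaussian_moment(2)[OF c, of "p $ k"]
    by (cases "i = k") (simp_all add: f_def[abs_def])
  show "integrable lborel (\<lambda>x::real^'n. exp (- \<i> * of_real (p \<bullet> x)) * of_real (x $ k * exp (- c * (norm x)\<^sup>2)))"
    using lborel_prod_vec(1)[of f, OF fi] by (simp only: P)
  have "(\<integral>x. exp (- \<i> * of_real (p \<bullet> x)) * of_real (x $ k * exp (- c * (norm x)\<^sup>2)) \<partial>lborel)
      = (\<Prod>i\<in>UNIV. (if i = k then - \<i> * of_real (p $ k / (2 * c)) else 1) *
          complex_of_real (sqrt (pi / c) * exp (- (p $ i)\<^sup>2 / (4 * c))))"
    using lborel_prod_vec(2)[of f, OF fi] unfolding P If .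
  also have "\<dots> = - \<i> * of_real (p $ k / (2 * c)) *
      (\<Prod>i\<in>UNIV. complex_of_real (sqrt (pi / c) * exp (- (p $ i)\<^sup>2 / (4 * c))))"
    by (subst prod.distrib) (simp add: prod.delta)
  also have "(\<Prod>i\<in>UNIV. complex_of_real (sqrt (pi / c) * exp (- (p $ i)\<^sup>2 / (4 * c))))
      = of_real (sqrt (pi / c) ^ CARD('n) * exp (- (norm p)\<^sup>2 / (4 * c)))"
    unfolding nrm by (simp add: prod.distrib exp_sum sum_divide_distrib flip: sum_negf of_real_prod)
  finally show "(\<integral>x. exp (- \<i> * of_real (p \<bullet> x)) * of_real (x $ k * exp (- c * (norm x)\<^sup>2)) \<partial>lborel)
           = - \<i> * of_real (p $ k / (2 * c) * (sqrt (pi / c) ^ CARD('n) * exp (- (norm p)\<^sup>2 / (4 * c))))"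
    by (simp add: mult.assoc)
qed

lemma integral_gaussian_vec:
  fixes c :: real
  assumes c: "c > 0"
  shows "integrable lborel (\<lambda>x::real^'n. exp (- c * (norm x)\<^sup>2))"
    and "(\<integral>x. exp (- c * (norm (x::real^'n))\<^sup>2) \<partial>lborel) = sqrt (pi / c) ^ CARD('n)"
proof -
  have "integrable lborel (\<lambda>x::real^'n. complex_of_real (exp (- c * (norm x)\<^sup>2)))"
    using integral_exp_gaussian_vec(1)[OF c, of 0] by simp
  then show "integrable lborel (\<lambda>x::real^'n. exp (- c * (norm x)\<^sup>2))"
    using integrable_Re by fastforce
  have "complex_of_real (\<integral>x. exp (- c * (norm (x::real^'n))\<^sup>2) \<partial>lborel) = of_real (sqrt (pi / c) ^ CARD('n))"
    using integral_exp_gaussian_vec(2)[OF c, of "0::real^'n"]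
    by (simp flip: integral_complex_of_real)
  then show "(\<integral>x. exp (- c * (norm (x::real^'n))\<^sup>2) \<partial>lborel) = sqrt (pi / c) ^ CARD('n)"
    using of_real_eq_iff by blast
qed

section \<open>Gaussian wave packets\<close>

text \<open>The normalisation makes \<^term>\<open>exp (- s * (norm p)\<^sup>2)\<close> the Fourier transform of \<open>heat s\<close>.\<close>

definition heat :: "real \<Rightarrow> real^3 \<Rightarrow> real" where
  "heat s x = exp (- (norm x)\<^sup>2 / (4 * s)) / sqrt (2 * s) ^ 3"

lemma two_pi_powr: "(2 * pi) powr (-3/2) = 1 / sqrt (2 * pi) ^ 3"
  by (simp add: powr_half_sqrt[symmetric] powr_powr powr_minus_divide flip: powr_numeral)

lemma fourier3_heat:
  assumes s: "s > 0"
  shows "fourier3 (\<lambda>x. of_real (heat s x)) p = of_real (exp (- s * (norm p)\<^sup>2))"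
proof -
  define c where "c = 1 / (4 * s)"
  have c: "c > 0" using s by (simp add: c_def)
  have "(\<integral>x. exp (- \<i> * of_real (p \<bullet> x)) * complex_of_real (heat s x) \<partial>lborel) =
      (\<integral>x. (1 / of_real (sqrt (2 * s) ^ 3)) * (exp (- \<i> * of_real (p \<bullet> x)) * of_real (exp (- c * (norm x)\<^sup>2))) \<partial>lborel)"
    by (simp add: heat_def c_def field_simps)
  also have "\<dots> = of_real (1 / (sqrt (2 * s) ^ 3) * (sqrt (4 * pi * s) ^ 3 * exp (- s * (norm p)\<^sup>2)))"
    unfolding integral_mult_right_zero integral_exp_gaussian_vec(2)[OF c] by (simp add: c_def mult_ac)
  also have "1 / (sqrt (2 * s) ^ 3) * (sqrt (4 * pi * s) ^ 3 * exp (- s * (norm p)\<^sup>2)) = sqrt (2 * pi) ^ 3 * exp (- s * (norm p)\<^sup>2)"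
    using s by (simp add: real_sqrt_mult field_simps power3_eq_cube)
  finally show ?thesis
    unfolding fourier3_def two_pi_powr by simp
qed

text \<open>The function transformed is -i times the k-th partial derivative of
  \<open>heat s\<close>, which is why its transform acquires the factor
  \<open>p $ k\<close>.\<close>

lemma fourier3_heat_moment:
  assumes s: "s > 0"
  shows "fourier3 (\<lambda>x. \<i> * of_real (x $ k * (heat s x / (2 * s)))) p = of_real (p $ k * exp (- s * (norm p)\<^sup>2))"
proof -
  define c where "c = 1 / (4 * s)"
  have c: "c > 0" using s by (simp add: c_def)
  have "(\<integral>x. exp (- \<i> * of_real (p \<bullet> x)) * (\<i> * complex_of_real (x $ k * (heat s x / (2 * s)))) \<partial>lborel) =
      (\<integral>x. (\<i> / of_real (2 * s * sqrt (2 * s) ^ 3)) * (exp (- \<i> * of_real (p \<bullet> x)) * of_real (x $ k * exp (- c * (norm x)\<^sup>2))) \<partial>lborel)"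
    by (simp add: heat_def c_def field_simps)
  also have "\<dots> = of_real (1 / (sqrt (2 * s) ^ 3) * (p $ k * (sqrt (4 * pi * s) ^ 3 * exp (- s * (norm p)\<^sup>2))))"
    unfolding integral_mult_right_zero integral_exp_gaussian_moment_vec(2)[OF c] using s
    by (simp add: c_def mult_ac)
  also have "1 / (sqrt (2 * s) ^ 3) * (p $ k * (sqrt (4 * pi * s) ^ 3 * exp (- s * (norm p)\<^sup>2))) = sqrt (2 * pi) ^ 3 * (p $ k * exp (- s * (norm p)\<^sup>2))"
    using s by (simp add: real_sqrt_mult field_simps power3_eq_cube)
  finally show ?thesis
    unfolding fourier3_def two_pi_powr by simp
qed

section \<open>Linearity, superposition and the multiplication formula for Fourier integrals\<close>

lemma integrable_fourier_kernel:
  fixes h :: "real^3 \<Rightarrow> complex"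
  assumes "integrable lborel h"
  shows "integrable lborel (\<lambda>x. exp (- \<i> * of_real (p \<bullet> x)) * h x)"
  by (rule Bochner_Integration.integrable_bound[OF assms])
     (use assms in \<open>auto simp: norm_mult integrable_iff_bounded\<close>)

lemma fourier3_add:
  assumes "integrable lborel g" "integrable lborel h"
  shows "fourier3 (\<lambda>x. g x + h x) p = fourier3 g p + fourier3 h p"
  unfolding fourier3_def using integrable_fourier_kernel[OF assms(1)] integrable_fourier_kernel[OF assms(2)]
  by (simp add: distrib_left Bochner_Integration.integral_add)

lemma fourier3_sum:
  assumes "\<And>i. i \<in> I \<Longrightarrow> integrable lborel (g i)"
  shows "fourier3 (\<lambda>x. \<Sum>i\<in>I. g i x) p = (\<Sum>i\<in>I. fourier3 (g i) p)"
  unfolding fourier3_def using integrable_fourier_kernel[OF assms]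
  by (simp add: sum_distrib_left Bochner_Integration.integral_sum)

text \<open>The scalar stands on the right so that fixed spinor components and u-dependent
  prefactors can be pulled out by rewriting.\<close>

lemma fourier3_mult_right: "fourier3 (\<lambda>x. h x * c) p = fourier3 h p * c"
  unfolding fourier3_def by (simp flip: mult.assoc)

lemma fourier3_superposition:
  fixes K :: "real \<Rightarrow> real^3 \<Rightarrow> complex"
  assumes K: "integrable (lborel \<Otimes>\<^sub>M lborel) (\<lambda>(u, x). K u x)"
  shows "fourier3 (\<lambda>x. \<integral>u. K u x \<partial>lborel) p = (\<integral>u. fourier3 (K u) p \<partial>lborel)"
proof -
  have m: "(\<lambda>(u, x). K u x) \<in> borel_measurable (lborel \<Otimes>\<^sub>M lborel)"
    using K by (simp add: integrable_iff_bounded)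
  have "integrable (lborel \<Otimes>\<^sub>M lborel) (\<lambda>(u, x). exp (- \<i> * of_real (p \<bullet> x)) * K u x)"
    by (rule Bochner_Integration.integrable_bound[OF K]) (use m in \<open>auto simp: norm_mult split_beta'\<close>)
  from lborel_pair.Fubini_integral[OF this] show ?thesis
    unfolding fourier3_def by simp
qed

text \<open>The phase is symmetric in x and p and has modulus 1, so the product
  \<open>h x * g p\<close> dominates the double integral and Fubini exchanges the order.\<close>

lemma integral_fourier3_mult:
  assumes h: "integrable lborel h" and g: "integrable lborel g"
  shows "(\<integral>p. fourier3 h p * g p \<partial>lborel) = (\<integral>x. h x * fourier3 g x \<partial>lborel)"
proof -
  have [measurable]: "h \<in> borel_measurable borel" "g \<in> borel_measurable borel"
    using h g by (simp_all add: integrable_iff_bounded)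
  have gh: "integrable (lborel \<Otimes>\<^sub>M lborel) (\<lambda>(x, p). h x * g p)"
  proof (rule lborel_pair.Fubini_integrable)
    show "integrable lborel (\<lambda>x. \<integral>p. norm (case (x, p) of (x, p) \<Rightarrow> h x * g p) \<partial>lborel)"
      using h by (simp add: norm_mult)
    show "AE x in lborel. integrable lborel (\<lambda>p. case (x, p) of (x, p) \<Rightarrow> h x * g p)"
      using g by simp
  qed measurable
  have "integrable (lborel \<Otimes>\<^sub>M lborel) (\<lambda>(x, p). exp (- \<i> * of_real (p \<bullet> x)) * (h x * g p))"
    by (rule Bochner_Integration.integrable_bound[OF gh]) (auto simp: norm_mult split_beta')
  from lborel_pair.Fubini_integral[OF this]
  have "(\<integral>p. (\<integral>x. exp (- \<i> * of_real (p \<bullet> x)) * h x \<partial>lborel) * g p \<partial>lborel)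
      = (\<integral>x. h x * (\<integral>p. exp (- \<i> * of_real (x \<bullet> p)) * g p \<partial>lborel) \<partial>lborel)"
    by (simp add: mult_ac inner_commute flip: integral_mult_left_zero integral_mult_right_zero)
  then show ?thesis
    unfolding fourier3_def mult.assoc integral_mult_right_zero mult.left_commute[of "h _"] by simp
qed

section \<open>Comparison of a Gaussian with one of twice its variance\<close>

definition wide_heat :: "real \<Rightarrow> real^3 \<Rightarrow> real" where
  "wide_heat s x = exp (- (norm x)\<^sup>2 / (8 * s)) / sqrt s ^ 3"

lemma wide_heat_pos: "s > 0 \<Longrightarrow> 0 < wide_heat s x"
  by (simp add: wide_heat_def)

lemma heat_pos: "s > 0 \<Longrightarrow> 0 < heat s x"
  by (simp add: heat_def)

lemma borel_measurable_heat [measurable (raw)]: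
  assumes [measurable]: "f \<in> borel_measurable M" "g \<in> borel_measurable M"
  shows "(\<lambda>x. heat (f x) (g x)) \<in> borel_measurable M"
  unfolding heat_def by measurable

lemma borel_measurable_wide_heat [measurable (raw)]:
  assumes [measurable]: "f \<in> borel_measurable M" "g \<in> borel_measurable M"
  shows "(\<lambda>x. wide_heat (f x) (g x)) \<in> borel_measurable M"
  unfolding wide_heat_def by measurable

text \<open>The exponent is split into two equal halves. One half stays in \<open>wide_heat\<close>,
  the other is a spare decaying factor that can absorb powers of \<open>norm x\<close>.\<close>

lemma heat_eq_wide_heat:
  assumes s: "s > 0"
  shows "heat s x = exp (- (norm x / sqrt (8 * s))\<^sup>2) * wide_heat s x / sqrt 8"
proof -
  have "sqrt 8 = 2 * sqrt (2::real)" using real_sqrt_mult[of 4 2] by simp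
  moreover have "sqrt 2 ^ 3 = 2 * sqrt (2::real)" by (simp add: power3_eq_cube)
  ultimately have 1: "sqrt (2 * s) ^ 3 = sqrt 8 * sqrt s ^ 3"
    by (simp add: real_sqrt_mult power_mult_distrib)
  have 2: "(norm x / sqrt (8 * s))\<^sup>2 = (norm x)\<^sup>2 / (8 * s)"
    using s by (simp add: power_divide)
  have 3: "- (norm x)\<^sup>2 / (4 * s) = - ((norm x)\<^sup>2 / (8 * s)) + - (norm x)\<^sup>2 / (8 * s)"
    using s by (simp add: field_simps)
  show ?thesis
    unfolding heat_def wide_heat_def 1 2 3 exp_add by (simp add: mult_ac)
qed

lemma power2_times_exp_le: "y\<^sup>2 * exp (- y\<^sup>2) \<le> 1" for y :: real
proof -
  have "y\<^sup>2 \<le> exp (y\<^sup>2)" using exp_ge_add_one_self[of "y\<^sup>2"] by linarith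
  then show ?thesis by (simp add: exp_minus field_simps)
qed

lemma abs_times_exp_le: "y * exp (- y\<^sup>2) \<le> 1" for y :: real
proof -
  have "y \<le> exp (y\<^sup>2)"
    using exp_ge_add_one_self[of "y\<^sup>2"] abs_le_one_plus_square[of y] by linarith
  then show ?thesis by (simp add: exp_minus field_simps)
qed

text \<open>With y = |x| / sqrt (8 s), the spare factor \<open>exp (- y\<^sup>2)\<close> bounds y
  and y^2 by 1. Each power of |x| is thereby exchanged for a factor of order sqrt s.\<close>

lemma heat_le_wide_heat:
  assumes s: "s > 0"
  shows "heat s x \<le> wide_heat s x"
    and "norm x * heat s x \<le> sqrt s * wide_heat s x"
    and "(norm x)\<^sup>2 * (heat s x / (2 * s)) \<le> 4 * wide_heat s x"
proof -
  define y where "y = norm x / sqrt (8 * s)"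
  have y: "norm x = sqrt (8 * s) * y" "(norm x)\<^sup>2 = 8 * s * y\<^sup>2"
    using s by (auto simp: y_def power_divide)
  have h: "heat s x = exp (- y\<^sup>2) * wide_heat s x / sqrt 8"
    unfolding y_def by (rule heat_eq_wide_heat[OF s])
  note w = wide_heat_pos[OF s, of x]
  have s8: "1 \<le> sqrt (8::real)" by simp
  have "exp (- y\<^sup>2) * wide_heat s x \<le> 1 * wide_heat s x"
    by (rule mult_right_mono) (use w in auto)
  also have "\<dots> \<le> wide_heat s x * sqrt 8" using mult_left_mono[OF s8, of "wide_heat s x"] w by simp
  finally show "heat s x \<le> wide_heat s x" unfolding h by (simp add: field_simps)
  have "norm x * heat s x = sqrt s * ((y * exp (- y\<^sup>2)) * wide_heat s x)"
    unfolding h y by (simp add: real_sqrt_mult)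
  also have "\<dots> \<le> sqrt s * (1 * wide_heat s x)"
    by (intro mult_left_mono mult_right_mono abs_times_exp_le) (use w s in auto)
  finally show "norm x * heat s x \<le> sqrt s * wide_heat s x" by simp
  have "(norm x)\<^sup>2 * (heat s x / (2 * s)) = (4 / sqrt 8) * ((y\<^sup>2 * exp (- y\<^sup>2)) * wide_heat s x)"
    unfolding h y(2) using s by simp
  also have "\<dots> \<le> 4 * (1 * wide_heat s x)"
    by (intro mult_mono mult_right_mono power2_times_exp_le) (use w s s8 in \<open>auto simp: divide_le_eq\<close>)
  finally show "(norm x)\<^sup>2 * (heat s x / (2 * s)) \<le> 4 * wide_heat s x" by simp
qed

lemma integral_wide_heat:
  assumes s: "s > 0"
  shows "integrable lborel (wide_heat s)" "integral\<^sup>L lborel (wide_heat s) = sqrt (8 * pi) ^ 3"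
proof -
  define c where "c = 1 / (8 * s)"
  have c: "c > 0" using s by (simp add: c_def)
  have w: "wide_heat s = (\<lambda>x. exp (- c * (norm x)\<^sup>2) / sqrt s ^ 3)"
    by (auto simp: wide_heat_def c_def)
  show "integrable lborel (wide_heat s)"
    unfolding w using integral_gaussian_vec(1)[OF c] by auto
  show "integral\<^sup>L lborel (wide_heat s) = sqrt (8 * pi) ^ 3"
    unfolding w integral_divide_zero integral_gaussian_vec(2)[OF c]
    using s by (simp add: c_def real_sqrt_mult power_mult_distrib)
qed

lemma mult_divide_square: "r > 0 \<Longrightarrow> a * r / r\<^sup>2 = a / r" for r a :: real
  by (simp add: power2_eq_square)

lemma integral_wide_heat_square:
  assumes s: "s > 0"
  shows "integrable lborel (\<lambda>x. (wide_heat s x)\<^sup>2)"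
    "(\<integral>x. (wide_heat s x)\<^sup>2 \<partial>lborel) = sqrt (4 * pi) ^ 3 / sqrt s ^ 3"
proof -
  define c where "c = 1 / (4 * s)"
  have c: "c > 0" using s by (simp add: c_def)
  have w: "(\<lambda>x. (wide_heat s x)\<^sup>2) = (\<lambda>x. exp (- c * (norm x)\<^sup>2) / (sqrt s ^ 3)\<^sup>2)"
    by (auto simp: wide_heat_def c_def power_divide simp flip: exp_double)
  show "integrable lborel (\<lambda>x. (wide_heat s x)\<^sup>2)"
    unfolding w using integral_gaussian_vec(1)[OF c] by auto
  have sq: "sqrt (pi / c) = sqrt (4 * pi) * sqrt s"
    using s by (simp add: c_def mult_ac flip: real_sqrt_mult)
  show "(\<integral>x. (wide_heat s x)\<^sup>2 \<partial>lborel) = sqrt (4 * pi) ^ 3 / sqrt s ^ 3"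
    unfolding w integral_divide_zero integral_gaussian_vec(2)[OF c]
    unfolding sq power_mult_distrib using mult_divide_square[of "sqrt s ^ 3"] s by simp
qed

text \<open>The lower bound of order \<open>s powr (-3/2)\<close> is the growth of the norm against
  which the second moment is later compared.\<close>

lemma integral_heat_square:
  assumes s: "s > 0"
  shows "integrable lborel (\<lambda>x. (heat s x)\<^sup>2)"
    "1 / sqrt s ^ 3 \<le> (\<integral>x. (heat s x)\<^sup>2 \<partial>lborel)"
proof -
  define c where "c = 1 / (2 * s)"
  have c: "c > 0" using s by (simp add: c_def)
  have w: "(\<lambda>x. (heat s x)\<^sup>2) = (\<lambda>x. exp (- c * (norm x)\<^sup>2) / (sqrt (2 * s) ^ 3)\<^sup>2)"
    by (auto simp: heat_def c_def power_divide simp flip: exp_double)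
  show "integrable lborel (\<lambda>x. (heat s x)\<^sup>2)"
    unfolding w using integral_gaussian_vec(1)[OF c] by auto
  \<comment> \<open>The integral is exactly \<open>sqrt (2 * pi) ^ 3 / 2 ^ 3 / sqrt s ^ 3\<close>;
    pi >= 2 makes the constant in front at least 1.\<close>
  have "sqrt (2 * 2) \<le> sqrt (2 * pi)" using pi_ge_two by (intro real_sqrt_le_mono) simp
  then have "2 \<le> sqrt (2 * pi)" by simp
  then have "2 ^ 3 \<le> sqrt (2 * pi) ^ 3" by (rule power_mono) simp
  moreover have "(\<integral>x. (heat s x)\<^sup>2 \<partial>lborel) = sqrt (2 * pi) ^ 3 / 2 ^ 3 / sqrt s ^ 3"
    unfolding w integral_divide_zero integral_gaussian_vec(2)[OF c]
    using s by (simp add: c_def real_sqrt_mult power2_eq_square power3_eq_cube field_simps)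
  ultimately show "1 / sqrt s ^ 3 \<le> (\<integral>x. (heat s x)\<^sup>2 \<partial>lborel)"
    using s by (simp add: field_simps)
qed

text \<open>The common majorant of all Gaussian superpositions below; the widened Gaussian absorbs
  the powers of \<^term>\<open>norm x\<close>, half of the mass factor absorbs powers of \<^term>\<open>u\<close>.\<close>

definition envelope_kernel :: "real \<Rightarrow> real \<Rightarrow> real \<Rightarrow> real^3 \<Rightarrow> real" where
  "envelope_kernel m b u x = exp (- (m\<^sup>2 / 2) * u\<^sup>2) * wide_heat (b + u\<^sup>2) x"

definition envelope :: "real \<Rightarrow> real \<Rightarrow> real^3 \<Rightarrow> real" where
  "envelope m b x = (\<integral>u. envelope_kernel m b u x \<partial>lborel)"

section \<open>Integrability and size of the envelope\<close>

lemma borel_measurable_envelope_kernel [measurable (raw)]: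
  assumes [measurable]: "f \<in> borel_measurable M" "g \<in> borel_measurable M"
  shows "(\<lambda>x. envelope_kernel m b (f x) (g x)) \<in> borel_measurable M"
  unfolding envelope_kernel_def by measurable

lemma borel_measurable_envelope [measurable]: "envelope m b \<in> borel_measurable borel"
  unfolding envelope_def[abs_def] by measurable

lemma add_power2_pos: "b > 0 \<Longrightarrow> b + u\<^sup>2 > 0" for b u :: real
  by (simp add: add_pos_nonneg)

lemma envelope_kernel_pos: "b > 0 \<Longrightarrow> 0 < envelope_kernel m b u x"
  unfolding envelope_kernel_def by (simp add: wide_heat_pos add_power2_pos)

lemma wide_heat_le:
  assumes "b > 0" "b \<le> s" shows "wide_heat s x \<le> 1 / sqrt b ^ 3"
  unfolding wide_heat_def using assms by (intro frac_le power_mono) auto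

lemma integrable_envelope_kernel:
  assumes b: "b > 0" and m: "m > 0"
  shows "integrable lborel (\<lambda>u. envelope_kernel m b u x)"
proof (rule Bochner_Integration.integrable_bound)
  show "integrable lborel (\<lambda>u. exp (- (m\<^sup>2 / 2) * u\<^sup>2) * (1 / sqrt b ^ 3))"
    using integral_gaussian_real(1)[of "m\<^sup>2 / 2"] m by simp
  show "AE u in lborel. norm (envelope_kernel m b u x) \<le> norm (exp (- (m\<^sup>2 / 2) * u\<^sup>2) * (1 / sqrt b ^ 3))"
  proof (rule AE_I2)
    fix u :: real
    have "envelope_kernel m b u x \<le> exp (- (m\<^sup>2 / 2) * u\<^sup>2) * (1 / sqrt b ^ 3)"
      unfolding envelope_kernel_def by (intro mult_left_mono wide_heat_le) (use b in auto)
    also have "\<dots> \<le> norm (exp (- (m\<^sup>2 / 2) * u\<^sup>2) * (1 / sqrt b ^ 3))"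
      by (simp only: real_norm_def abs_ge_self)
    finally show "norm (envelope_kernel m b u x) \<le> norm (exp (- (m\<^sup>2 / 2) * u\<^sup>2) * (1 / sqrt b ^ 3))"
      using envelope_kernel_pos[OF b, of m u x] by simp
  qed
qed measurable

lemma envelope_nonneg: "b > 0 \<Longrightarrow> 0 \<le> envelope m b x"
  unfolding envelope_def by (intro integral_nonneg_AE AE_I2 less_imp_le envelope_kernel_pos)

text \<open>The integral of \<open>wide_heat s\<close> over space does not depend on s, so
  integrating first in x leaves only the Gaussian mass factor in u.\<close>

lemma integrable_envelope_kernel_pair:
  assumes b: "b > 0" and m: "m > 0"
  shows "integrable (lborel \<Otimes>\<^sub>M lborel) (\<lambda>(u, x). envelope_kernel m b u x)"
proof (rule lborel_pair.Fubini_integrable)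
  have "(\<integral>x. norm (envelope_kernel m b u x) \<partial>lborel) = exp (- (m\<^sup>2 / 2) * u\<^sup>2) * sqrt (8 * pi) ^ 3" for u
    using integral_wide_heat(2)[OF add_power2_pos[OF b]] envelope_kernel_pos[OF b, of m u]
    by (simp add: less_imp_le envelope_kernel_def)
  then show "integrable lborel (\<lambda>u. \<integral>x. norm (case (u, x) of (u, x) \<Rightarrow> envelope_kernel m b u x) \<partial>lborel)"
    using integral_gaussian_real(1)[of "m\<^sup>2 / 2"] m by simp
  show "AE u in lborel. integrable lborel (\<lambda>x. case (u, x) of (u, x) \<Rightarrow> envelope_kernel m b u x)"
    using integral_wide_heat(1)[OF add_power2_pos[OF b]] by (simp add: envelope_kernel_def)
qed measurable

lemma integrable_envelope:
  assumes b: "b > 0" and m: "m > 0"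
  shows "integrable lborel (envelope m b)"
  using lborel_pair.integrable_snd[OF integrable_envelope_kernel_pair[OF assms]] by (simp add: envelope_def[abs_def])

lemma integrable_pair_bound_envelope_kernel:
  fixes K :: "real \<Rightarrow> real^3 \<Rightarrow> complex"
  assumes b: "b > 0" and m: "m > 0"
    and K: "(\<lambda>(u, x). K u x) \<in> borel_measurable (lborel \<Otimes>\<^sub>M lborel)"
    and le: "\<And>u x. norm (K u x) \<le> c * envelope_kernel m b u x"
  shows "integrable (lborel \<Otimes>\<^sub>M lborel) (\<lambda>(u, x). K u x)"
proof (rule Bochner_Integration.integrable_bound[OF _ K])
  show "integrable (lborel \<Otimes>\<^sub>M lborel) (\<lambda>z. c * (case z of (u, x) \<Rightarrow> envelope_kernel m b u x))"
    using integrable_envelope_kernel_pair[OF b m] by simp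
  show "AE z in lborel \<Otimes>\<^sub>M lborel. norm (case z of (u, x) \<Rightarrow> K u x)
      \<le> norm (c * (case z of (u, x) \<Rightarrow> envelope_kernel m b u x))"
    by (rule AE_I2, clarify) (use order_trans[OF le abs_ge_self] in simp)
qed

text \<open>Rescaling u by \<open>sqrt b\<close> reduces this to the arctangent integral. It is the
  total mass of the weight in the Cauchy-Schwarz estimate for the envelope.\<close>

lemma nn_integral_inverse_quadratic:
  assumes b: "b > 0"
  shows "(\<integral>\<^sup>+u. ennreal (1 / (b + u\<^sup>2)) \<partial>lborel) = ennreal (pi / sqrt b)"
proof -
  have i: "integrable lborel (\<lambda>x::real. inverse (1 + x\<^sup>2))" "(\<integral>x. inverse (1 + (x::real)\<^sup>2) \<partial>lborel) = pi"
    using integrable_inverse_1_plus_square LBINT_inverse_1_plus_square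
    by (simp_all add: set_integrable_def interval_lebesgue_integral_def set_lebesgue_integral_def)
  have "(\<integral>\<^sup>+u. ennreal (1 / (b + u\<^sup>2)) \<partial>lborel)
      = sqrt b * (\<integral>\<^sup>+u. ennreal (1 / (b + (0 + sqrt b * u)\<^sup>2)) \<partial>lborel)"
    by (subst nn_integral_real_affine[where c = "sqrt b" and t = 0]) (use b in auto)
  also have "(\<lambda>u. ennreal (1 / (b + (0 + sqrt b * u)\<^sup>2))) = (\<lambda>u. ennreal (1 / b) * ennreal (inverse (1 + u\<^sup>2)))"
    using b by (auto simp: power_mult_distrib field_simps simp flip: ennreal_mult)
  also have "(\<integral>\<^sup>+u. ennreal (1 / b) * ennreal (inverse (1 + u\<^sup>2)) \<partial>lborel) = ennreal (1 / b) * ennreal pi"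
    using i by (subst nn_integral_cmult) (simp_all add: nn_integral_eq_integral)
  also have "ennreal (sqrt b) * (ennreal (1 / b) * ennreal pi) = ennreal (sqrt b * (1 / b * pi))"
    using b by (simp flip: ennreal_mult)
  also have "sqrt b * (1 / b * pi) = pi / sqrt b"
    using b by (simp add: field_simps)
  finally show ?thesis .
qed

lemma square_times_divide_cube: "r > 0 \<Longrightarrow> r\<^sup>2 * (c / r ^ 3) = c / r" for r c :: real
  by (simp add: power2_eq_square power3_eq_cube)

text \<open>Cauchy-Schwarz in \<open>u\<close> with the weight \<open>1 / (b + u\<^sup>2)\<close>. The crude estimate without this weight
  gives only \<open>b powr (-3/2)\<close>, which is the size of the total norm and hence useless.\<close>

lemma integral_envelope_square:
  assumes b: "b > 0" and m: "m > 0"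
  shows "integrable lborel (\<lambda>x. (envelope m b x)\<^sup>2)"
    and "(\<integral>x. (envelope m b x)\<^sup>2 \<partial>lborel) \<le> pi * sqrt (4 * pi) ^ 3 * sqrt (pi / m\<^sup>2) / b"
proof -
  let ?c = "pi * sqrt (4 * pi) ^ 3 * sqrt (pi / m\<^sup>2) / b"
  \<comment> \<open>The kernel is factored as \<open>?f u * ?g u x\<close>, so that the square of
    \<open>?f\<close> is the weight.\<close>
  let ?f = "\<lambda>u. 1 / sqrt (b + u\<^sup>2)" and ?g = "\<lambda>u x. sqrt (b + u\<^sup>2) * envelope_kernel m b u x"
  note s = add_power2_pos[OF b]
  have envelope: "ennreal (envelope m b x) = (\<integral>\<^sup>+u. ennreal (?f u) * ennreal (?g u x) \<partial>lborel)" for x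
  proof -
    have "ennreal (envelope m b x) = (\<integral>\<^sup>+u. ennreal (envelope_kernel m b u x) \<partial>lborel)"
      unfolding envelope_def using envelope_kernel_pos[OF b] integrable_envelope_kernel[OF b m]
      by (intro nn_integral_eq_integral[symmetric]) (auto simp: less_imp_le)
    also have "\<dots> = (\<integral>\<^sup>+u. ennreal (?f u) * ennreal (?g u x) \<partial>lborel)"
      using s envelope_kernel_pos[OF b] less_imp_neq[OF s]
      by (intro nn_integral_cong) (simp add: less_imp_le flip: ennreal_mult)
    finally show ?thesis .
  qed
  have f2: "(ennreal (?f u))\<^sup>2 = ennreal (1 / (b + u\<^sup>2))" for u
    using s[of u] by (simp add: ennreal_power power_divide)
  \<comment> \<open>The squared integral of \<open>wide_heat s\<close> is of order
    \<open>s powr (-3/2)\<close>. The factor s = b + u^2 from the weight improves this to 1 / sqrt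
    s, which is at most 1 / sqrt b.\<close>
  have g2: "(\<integral>\<^sup>+x. (ennreal (?g u x))\<^sup>2 \<partial>lborel) \<le> ennreal (exp (- m\<^sup>2 * u\<^sup>2)) * ennreal (sqrt (4 * pi) ^ 3 / sqrt b)" for u
  proof -
    have "(?g u x)\<^sup>2 = exp (- m\<^sup>2 * u\<^sup>2) * ((b + u\<^sup>2) * (wide_heat (b + u\<^sup>2) x)\<^sup>2)" for x
      using s[of u] by (simp add: envelope_kernel_def power_mult_distrib flip: exp_double)
    then have "(\<integral>\<^sup>+x. (ennreal (?g u x))\<^sup>2 \<partial>lborel)
        = (\<integral>\<^sup>+x. ennreal (exp (- m\<^sup>2 * u\<^sup>2) * ((b + u\<^sup>2) * (wide_heat (b + u\<^sup>2) x)\<^sup>2)) \<partial>lborel)"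
      using s[of u] envelope_kernel_pos[OF b] by (simp add: ennreal_power less_imp_le del: power_mult_distrib)
    also have "\<dots> = ennreal (exp (- m\<^sup>2 * u\<^sup>2) * ((b + u\<^sup>2) * (sqrt (4 * pi) ^ 3 / sqrt (b + u\<^sup>2) ^ 3)))"
      using integral_wide_heat_square[OF s[of u]] s[of u]
      by (subst nn_integral_eq_integral) (auto simp: less_imp_le)
    also have "(b + u\<^sup>2) * (sqrt (4 * pi) ^ 3 / sqrt (b + u\<^sup>2) ^ 3) = sqrt (4 * pi) ^ 3 / sqrt (b + u\<^sup>2)"
      using square_times_divide_cube[of "sqrt (b + u\<^sup>2)" "sqrt (4 * pi) ^ 3"] s[of u] by simp
    also have "ennreal (exp (- m\<^sup>2 * u\<^sup>2) * (sqrt (4 * pi) ^ 3 / sqrt (b + u\<^sup>2)))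
        \<le> ennreal (exp (- m\<^sup>2 * u\<^sup>2) * (sqrt (4 * pi) ^ 3 / sqrt b))"
      using b by (intro ennreal_leI mult_left_mono divide_left_mono) (auto simp: add_pos_nonneg)
    finally show ?thesis using b by (subst ennreal_mult[symmetric]) auto
  qed
  have "(\<integral>\<^sup>+x. ennreal ((envelope m b x)\<^sup>2) \<partial>lborel)
      \<le> (\<integral>\<^sup>+x. ennreal (pi / sqrt b) * (\<integral>\<^sup>+u. (ennreal (?g u x))\<^sup>2 \<partial>lborel) \<partial>lborel)"
  proof (rule nn_integral_mono)
    fix x :: "real^3"
    have "ennreal ((envelope m b x)\<^sup>2) = (\<integral>\<^sup>+u. ennreal (?f u) * ennreal (?g u x) \<partial>lborel)\<^sup>2"
      using envelope_nonneg[OF b, of m x] by (simp add: envelope[symmetric] ennreal_power)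
    also have "\<dots> \<le> (\<integral>\<^sup>+u. (ennreal (?f u))\<^sup>2 \<partial>lborel) * (\<integral>\<^sup>+u. (ennreal (?g u x))\<^sup>2 \<partial>lborel)"
      by (rule Cauchy_Schwarz_nn_integral) measurable
    also have "(\<integral>\<^sup>+u. (ennreal (?f u))\<^sup>2 \<partial>lborel) = ennreal (pi / sqrt b)"
      unfolding f2 by (rule nn_integral_inverse_quadratic[OF b])
    finally show "ennreal ((envelope m b x)\<^sup>2) \<le> ennreal (pi / sqrt b) * (\<integral>\<^sup>+u. (ennreal (?g u x))\<^sup>2 \<partial>lborel)" .
  qed
  also have "\<dots> = ennreal (pi / sqrt b) * (\<integral>\<^sup>+u. (\<integral>\<^sup>+x. (ennreal (?g u x))\<^sup>2 \<partial>lborel) \<partial>lborel)"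
    by (subst nn_integral_cmult, measurable, subst lborel_pair.Fubini', measurable)
  also have "\<dots> \<le> ennreal (pi / sqrt b) *
      (\<integral>\<^sup>+u. ennreal (exp (- m\<^sup>2 * u\<^sup>2)) * ennreal (sqrt (4 * pi) ^ 3 / sqrt b) \<partial>lborel)"
    by (intro mult_left_mono nn_integral_mono g2) auto
  also have "\<dots> = ennreal (pi / sqrt b) * (ennreal (sqrt (pi / m\<^sup>2)) * ennreal (sqrt (4 * pi) ^ 3 / sqrt b))"
    using integral_gaussian_real[of "m\<^sup>2"] m
    by (simp add: nn_integral_multc nn_integral_eq_integral)
  \<comment> \<open>One factor 1 / sqrt b comes from the mass of the weight and one from
    \<open>g2\<close>; together they give 1 / b.\<close>
  also have "\<dots> = ennreal ?c"
    using b m by (simp add: mult_ac flip: ennreal_mult)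
  finally have le: "(\<integral>\<^sup>+x. ennreal ((envelope m b x)\<^sup>2) \<partial>lborel) \<le> ennreal ?c" .
  show i: "integrable lborel (\<lambda>x. (envelope m b x)\<^sup>2)"
    using le by (intro integrableI_bounded) (auto simp: le_less_trans)
  have "ennreal (\<integral>x. (envelope m b x)\<^sup>2 \<partial>lborel) \<le> ennreal ?c"
    using le i by (simp add: nn_integral_eq_integral)
  then show "(\<integral>x. (envelope m b x)\<^sup>2 \<partial>lborel) \<le> ?c"
    using b by (subst (asm) ennreal_le_iff) auto
qed

text \<open>With \<open>E\<^sup>2 = |p|\<^sup>2 + m\<^sup>2\<close>, integrating \<open>exp (- E\<^sup>2 u\<^sup>2)\<close> over the line gives \<open>sqrt pi / E\<close>. Hence
  \<open>inv_energy m b\<close> has Fourier transform \<open>exp (- b |p|\<^sup>2) / E\<close>. Differentiating \<open>heat s\<close> produces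
  the factor \<open>1 / (2 s)\<close> in \<open>inv_energy_grad\<close>, so that \<open>\<i> x\<^sub>k inv_energy_grad\<close> has transform
  \<open>p\<^sub>k exp (- b |p|\<^sup>2) / E\<close>.\<close>

definition inv_energy :: "real \<Rightarrow> real \<Rightarrow> real^3 \<Rightarrow> real" where
  "inv_energy m b x = (\<integral>u. exp (- m\<^sup>2 * u\<^sup>2) * heat (b + u\<^sup>2) x / sqrt pi \<partial>lborel)"

definition inv_energy_grad :: "real \<Rightarrow> real \<Rightarrow> real^3 \<Rightarrow> real" where
  "inv_energy_grad m b x = (\<integral>u. exp (- m\<^sup>2 * u\<^sup>2) * (heat (b + u\<^sup>2) x / (2 * (b + u\<^sup>2))) / sqrt pi \<partial>lborel)"

section \<open>Bounds and Fourier transforms of the inverse-energy profiles\<close>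

lemma borel_measurable_inv_energy [measurable]: "inv_energy m b \<in> borel_measurable borel"
  unfolding inv_energy_def[abs_def] by measurable

lemma borel_measurable_inv_energy_grad [measurable]: "inv_energy_grad m b \<in> borel_measurable borel"
  unfolding inv_energy_grad_def[abs_def] by measurable

lemma inv_energy_integrand_le:
  assumes h: "h \<ge> 0"
  shows "exp (- m\<^sup>2 * u\<^sup>2) * h / sqrt pi \<le> exp (- (m\<^sup>2 / 2) * u\<^sup>2) * h"
proof -
  have "1 \<le> sqrt pi" using pi_ge_two by simp
  then have "h / sqrt pi \<le> h" using h by (simp add: divide_le_eq mult_le_cancel_left1)
  moreover have "exp (- m\<^sup>2 * u\<^sup>2) \<le> exp (- (m\<^sup>2 / 2) * u\<^sup>2)" by simp
  ultimately show ?thesis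
    using mult_mono[of "exp (- m\<^sup>2 * u\<^sup>2)" "exp (- (m\<^sup>2 / 2) * u\<^sup>2)" "h / sqrt pi" h] h by simp
qed

text \<open>\<open>B\<close> and \<open>C\<close> are the integrands of \<open>inv_energy\<close>
  and \<open>inv_energy_grad\<close>. The second and fourth bounds have constants independent of b,
  as the second moment estimate requires. In the second, b \<le> 1 gives sqrt (b + u^2) \<le> 1 +
  u^2, which the mass factor absorbs. The constant of the third blows up as b tends to 0; that bound
  serves integrability at fixed b.\<close>

lemma envelope_kernel_bounds:
  assumes b: "b > 0" and m: "m > 0"
  defines "B \<equiv> \<lambda>u x. exp (- m\<^sup>2 * u\<^sup>2) * heat (b + u\<^sup>2) x / sqrt pi"
    and "C \<equiv> \<lambda>u x. exp (- m\<^sup>2 * u\<^sup>2) * (heat (b + u\<^sup>2) x / (2 * (b + u\<^sup>2))) / sqrt pi"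
  shows "B u x \<le> envelope_kernel m b u x"
    and "b \<le> 1 \<Longrightarrow> norm x * B u x \<le> (1 + 2 / m\<^sup>2) * envelope_kernel m b u x"
    and "norm x * C u x \<le> 1 / sqrt b * envelope_kernel m b u x"
    and "(norm x)\<^sup>2 * C u x \<le> 4 * envelope_kernel m b u x"
proof -
  define s where "s = b + u\<^sup>2"
  have s: "s > 0" "b \<le> s" using add_power2_pos[OF b, of u] by (auto simp: s_def)
  let ?e = "exp (- (m\<^sup>2 / 2) * u\<^sup>2)" and ?e2 = "exp (- m\<^sup>2 * u\<^sup>2)"
  note w = wide_heat_pos[OF s(1), of x] and h = heat_pos[OF s(1), of x] and le = heat_le_wide_heat[OF s(1), of x]
  have k: "envelope_kernel m b u x = ?e * wide_heat s x" by (simp add: envelope_kernel_def s_def)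
  have B: "B u x = ?e2 * heat s x / sqrt pi" and C: "C u x = ?e2 * (heat s x / (2 * s)) / sqrt pi"
    by (simp_all add: B_def C_def s_def)
  have "B u x \<le> ?e * heat s x" unfolding B by (rule inv_energy_integrand_le) (use h in simp)
  also have "\<dots> \<le> envelope_kernel m b u x" unfolding k by (intro mult_left_mono le) simp
  finally show 1: "B u x \<le> envelope_kernel m b u x" .
  {
    assume b1: "b \<le> 1"
    have "s \<le> 1 + u\<^sup>2" using b1 by (simp add: s_def)
    also have "\<dots> \<le> (1 + u\<^sup>2)\<^sup>2" by (rule self_le_power) auto
    finally have "sqrt s \<le> sqrt ((1 + u\<^sup>2)\<^sup>2)" by (rule real_sqrt_le_mono)
    then have 1: "sqrt s \<le> 1 + u\<^sup>2" by simp
    \<comment> \<open>Half of the mass factor \<open>?e2\<close> is spent on absorbing u^2; the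
      remaining half is \<open>?e\<close>.\<close>
    have "(m\<^sup>2 / 2) * u\<^sup>2 \<le> exp ((m\<^sup>2 / 2) * u\<^sup>2)"
      using exp_ge_add_one_self[of "(m\<^sup>2 / 2) * u\<^sup>2"] by linarith
    then have "u\<^sup>2 \<le> 2 / m\<^sup>2 * exp ((m\<^sup>2 / 2) * u\<^sup>2)"
      using m by (simp add: field_simps)
    moreover have "1 \<le> exp ((m\<^sup>2 / 2) * u\<^sup>2)" by simp
    ultimately have 2: "sqrt s \<le> (1 + 2 / m\<^sup>2) * exp ((m\<^sup>2 / 2) * u\<^sup>2)"
      using 1 unfolding distrib_right mult_1_left by linarith
    have "1 \<le> sqrt pi" using pi_ge_two by simp
    then have "1 / sqrt pi \<le> 1" by simp
    then have "norm x * B u x \<le> ?e2 * (norm x * heat s x)"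
      unfolding B using h mult_left_mono[of "1 / sqrt pi" 1 "?e2 * (norm x * heat s x)"] by (simp add: mult_ac)
    also have "\<dots> \<le> ?e2 * (sqrt s * wide_heat s x)"
      by (intro mult_left_mono le) simp
    also have "\<dots> \<le> ?e2 * (((1 + 2 / m\<^sup>2) * exp ((m\<^sup>2 / 2) * u\<^sup>2)) * wide_heat s x)"
      by (intro mult_left_mono mult_right_mono 2) (use w in auto)
    also have "\<dots> = (1 + 2 / m\<^sup>2) * ((?e2 * exp ((m\<^sup>2 / 2) * u\<^sup>2)) * wide_heat s x)"
      by (simp only: mult_ac)
    also have "?e2 * exp ((m\<^sup>2 / 2) * u\<^sup>2) = ?e"
      by (simp flip: exp_add)
    finally show "norm x * B u x \<le> (1 + 2 / m\<^sup>2) * envelope_kernel m b u x" unfolding k .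
  }
  have "norm x * C u x = ?e2 * (norm x * heat s x / (2 * s)) / sqrt pi"
    unfolding C by simp
  also have "\<dots> \<le> ?e * (norm x * heat s x / (2 * s))"
    by (rule inv_energy_integrand_le) (use h s in simp)
  also have "\<dots> \<le> ?e * (sqrt s * wide_heat s x / (2 * s))"
    by (intro mult_left_mono divide_right_mono le) (use s in auto)
  also have "sqrt s * wide_heat s x / (2 * s) = 1 / (2 * sqrt s) * wide_heat s x"
    using s by (simp add: field_simps)
  also have "?e * (1 / (2 * sqrt s) * wide_heat s x) \<le> ?e * (1 / sqrt b * wide_heat s x)"
  proof (intro mult_left_mono mult_right_mono)
    have "sqrt b \<le> sqrt s" "0 < sqrt b" using s b by auto
    then have "sqrt b \<le> 2 * sqrt s" by linarith
    then show "1 / (2 * sqrt s) \<le> 1 / sqrt b" using b by (intro frac_le) auto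
  qed (use w in auto)
  finally show "norm x * C u x \<le> 1 / sqrt b * envelope_kernel m b u x"
    unfolding k by (simp add: mult_ac)
  have "(norm x)\<^sup>2 * C u x = ?e2 * ((norm x)\<^sup>2 * (heat s x / (2 * s))) / sqrt pi"
    unfolding C by simp
  also have "\<dots> \<le> ?e * ((norm x)\<^sup>2 * (heat s x / (2 * s)))"
    by (rule inv_energy_integrand_le) (use h s in simp)
  also have "\<dots> \<le> ?e * (4 * wide_heat s x)"
    by (intro mult_left_mono le) auto
  finally show "(norm x)\<^sup>2 * C u x \<le> 4 * envelope_kernel m b u x"
    unfolding k by (simp add: mult_ac)
qed

lemma integral_le_envelope:
  assumes b: "b > 0" and m: "m > 0"
    and f: "f \<in> borel_measurable lborel" "\<And>u. 0 \<le> f u" "\<And>u. f u \<le> c * envelope_kernel m b u x"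
  shows "integral\<^sup>L lborel f \<le> c * envelope m b x"
proof -
  have "integral\<^sup>L lborel f \<le> (\<integral>u. c * envelope_kernel m b u x \<partial>lborel)"
    using integrable_envelope_kernel[OF b m] f
    by (intro integral_mono Bochner_Integration.integrable_bound[OF _ f(1), of "\<lambda>u. c * envelope_kernel m b u x"])
       (auto intro!: AE_I2 order_trans[OF f(3) abs_ge_self])
  then show ?thesis by (simp add: envelope_def)
qed

lemma inv_energy_inv_energy_grad_bounds:
  assumes b: "b > 0" and m: "m > 0"
  shows "0 \<le> inv_energy m b x" "0 \<le> inv_energy_grad m b x"
    and "inv_energy m b x \<le> envelope m b x"
    and "b \<le> 1 \<Longrightarrow> norm x * inv_energy m b x \<le> (1 + 2 / m\<^sup>2) * envelope m b x"
    and "norm x * inv_energy_grad m b x \<le> 1 / sqrt b * envelope m b x"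
    and "(norm x)\<^sup>2 * inv_energy_grad m b x \<le> 4 * envelope m b x"
proof -
  note s = add_power2_pos[OF b] and kb = envelope_kernel_bounds[OF b m]
  note h = less_imp_le[OF heat_pos[OF s]] and s' = less_imp_le[OF s]
  have "0 \<le> exp (- m\<^sup>2 * u\<^sup>2) * heat (b + u\<^sup>2) x / sqrt pi" for u
    using h[of u x] by simp
  note hB = this
  then show "0 \<le> inv_energy m b x"
    unfolding inv_energy_def by (intro integral_nonneg_AE AE_I2)
  have "0 \<le> exp (- m\<^sup>2 * u\<^sup>2) * (heat (b + u\<^sup>2) x / (2 * (b + u\<^sup>2))) / sqrt pi" for u
    using h[of u x] s'[of u] by (intro divide_nonneg_nonneg mult_nonneg_nonneg) auto
  note hC = this
  then show "0 \<le> inv_energy_grad m b x"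
    unfolding inv_energy_grad_def by (intro integral_nonneg_AE AE_I2)
  show "inv_energy m b x \<le> envelope m b x"
    unfolding inv_energy_def using integral_le_envelope[OF b m _ hB, where c = 1 and x = x] kb(1) by simp
  show "norm x * inv_energy m b x \<le> (1 + 2 / m\<^sup>2) * envelope m b x" if "b \<le> 1"
    unfolding inv_energy_def integral_mult_right_zero[symmetric]
    by (rule integral_le_envelope[OF b m _ mult_nonneg_nonneg[OF norm_ge_zero hB] kb(2)[OF that]]) measurable
  show "norm x * inv_energy_grad m b x \<le> 1 / sqrt b * envelope m b x"
    unfolding inv_energy_grad_def integral_mult_right_zero[symmetric]
    by (rule integral_le_envelope[OF b m _ mult_nonneg_nonneg[OF norm_ge_zero hC] kb(3)]) measurable
  show "(norm x)\<^sup>2 * inv_energy_grad m b x \<le> 4 * envelope m b x"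
    unfolding inv_energy_grad_def integral_mult_right_zero[symmetric]
    by (rule integral_le_envelope[OF b m _ mult_nonneg_nonneg[OF zero_le_power2 hC] kb(4)]) measurable
qed

text \<open>The exponent regroups as -b |p|^2 - E^2 u^2, which leaves a Gaussian in u with integral
  sqrt pi / E.\<close>

lemma integral_gaussian_energy:
  assumes m: "m > 0"
  shows "(\<integral>u. exp (- m\<^sup>2 * u\<^sup>2) * exp (- (b + u\<^sup>2) * (norm (p::real^3))\<^sup>2) / sqrt pi \<partial>lborel)
    = exp (- b * (norm p)\<^sup>2) / sqrt ((norm p)\<^sup>2 + m\<^sup>2)"
proof -
  let ?E = "(norm p)\<^sup>2 + m\<^sup>2"
  have E: "?E > 0" using m by (simp add: add_nonneg_pos)
  have "exp (- m\<^sup>2 * u\<^sup>2) * exp (- (b + u\<^sup>2) * (norm p)\<^sup>2) / sqrt pi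
      = exp (- b * (norm p)\<^sup>2) / sqrt pi * exp (- ?E * u\<^sup>2)" for u
    by (simp add: algebra_simps flip: exp_add)
  then show ?thesis
    using integral_gaussian_real(2)[OF E] by (simp add: real_sqrt_divide)
qed

lemma fourier3_inv_energy:
  assumes b: "b > 0" and m: "m > 0"
  shows "fourier3 (\<lambda>x. of_real (inv_energy m b x)) p = of_real (exp (- b * (norm p)\<^sup>2) / sqrt ((norm p)\<^sup>2 + m\<^sup>2))"
proof -
  note s = add_power2_pos[OF b]
  let ?K = "\<lambda>u x. complex_of_real (exp (- m\<^sup>2 * u\<^sup>2) * heat (b + u\<^sup>2) x / sqrt pi)"
  have "integrable (lborel \<Otimes>\<^sub>M lborel) (\<lambda>(u, x). ?K u x)"
  proof (rule integrable_pair_bound_envelope_kernel[OF b m])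
    show "norm (?K u x) \<le> 1 * envelope_kernel m b u x" for u x
      using envelope_kernel_bounds(1)[OF b m, of u x] less_imp_le[OF heat_pos[OF s]] by (simp only: norm_of_real) simp
  qed measurable
  from fourier3_superposition[OF this, of p]
  have "fourier3 (\<lambda>x. of_real (inv_energy m b x)) p = (\<integral>u. fourier3 (?K u) p \<partial>lborel)"
    by (simp only: inv_energy_def integral_complex_of_real)
  also have "\<dots> = (\<integral>u. complex_of_real (exp (- m\<^sup>2 * u\<^sup>2) * exp (- (b + u\<^sup>2) * (norm p)\<^sup>2) / sqrt pi) \<partial>lborel)"
  proof (intro Bochner_Integration.integral_cong refl)
    fix u
    have "fourier3 (?K u) p = fourier3 (\<lambda>x. of_real (heat (b + u\<^sup>2) x) * of_real (exp (- m\<^sup>2 * u\<^sup>2) / sqrt pi)) p"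
      by (simp add: mult_ac)
    then show "fourier3 (?K u) p = complex_of_real (exp (- m\<^sup>2 * u\<^sup>2) * exp (- (b + u\<^sup>2) * (norm p)\<^sup>2) / sqrt pi)"
      unfolding fourier3_mult_right fourier3_heat[OF s] by (simp add: mult_ac)
  qed
  also have "\<dots> = of_real (exp (- b * (norm p)\<^sup>2) / sqrt ((norm p)\<^sup>2 + m\<^sup>2))"
    unfolding integral_complex_of_real integral_gaussian_energy[OF m] ..
  finally show ?thesis .
qed

lemma fourier3_inv_energy_grad:
  assumes b: "b > 0" and m: "m > 0"
  shows "fourier3 (\<lambda>x. \<i> * of_real (x $ k * inv_energy_grad m b x)) p
    = of_real (p $ k * (exp (- b * (norm p)\<^sup>2) / sqrt ((norm p)\<^sup>2 + m\<^sup>2)))"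
proof -
  note s = add_power2_pos[OF b]
  let ?R = "\<lambda>u x. exp (- m\<^sup>2 * u\<^sup>2) * (heat (b + u\<^sup>2) x / (2 * (b + u\<^sup>2))) / sqrt pi"
  let ?K = "\<lambda>u x. \<i> * complex_of_real (x $ k * ?R u x)"
  have [measurable]: "(\<lambda>x::real^3. x $ k) \<in> borel_measurable borel"
    by (intro borel_measurable_continuous_onI continuous_intros)
  have "integrable (lborel \<Otimes>\<^sub>M lborel) (\<lambda>(u, x). ?K u x)"
  proof (rule integrable_pair_bound_envelope_kernel[OF b m])
    fix u and x :: "real^3"
    have R: "0 \<le> ?R u x" using heat_pos[OF s[of u], of x] s[of u] by simp
    have "norm (?K u x) = \<bar>x $ k\<bar> * ?R u x"
      unfolding norm_mult norm_of_real abs_mult[of "x $ k"] abs_of_nonneg[OF R] by simp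
    also have "\<dots> \<le> norm x * ?R u x"
      by (rule mult_right_mono[OF component_le_norm_cart R])
    also have "\<dots> \<le> 1 / sqrt b * envelope_kernel m b u x" by (rule envelope_kernel_bounds(3)[OF b m])
    finally show "norm (?K u x) \<le> 1 / sqrt b * envelope_kernel m b u x" .
  qed measurable
  from fourier3_superposition[OF this, of p]
  have "fourier3 (\<lambda>x. \<i> * of_real (x $ k * inv_energy_grad m b x)) p = (\<integral>u. fourier3 (?K u) p \<partial>lborel)"
    by (simp only: inv_energy_grad_def integral_complex_of_real integral_mult_right_zero)
  also have "\<dots> = (\<integral>u. complex_of_real (p $ k * (exp (- m\<^sup>2 * u\<^sup>2) * exp (- (b + u\<^sup>2) * (norm p)\<^sup>2) / sqrt pi)) \<partial>lborel)"
  proof (intro Bochner_Integration.integral_cong refl)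
    fix u
    have "fourier3 (?K u) p = fourier3 (\<lambda>x. (\<i> * of_real (x $ k * (heat (b + u\<^sup>2) x / (2 * (b + u\<^sup>2))))) * of_real (exp (- m\<^sup>2 * u\<^sup>2) / sqrt pi)) p"
      by (simp add: mult_ac)
    then show "fourier3 (?K u) p = complex_of_real (p $ k * (exp (- m\<^sup>2 * u\<^sup>2) * exp (- (b + u\<^sup>2) * (norm p)\<^sup>2) / sqrt pi))"
      unfolding fourier3_mult_right fourier3_heat_moment[OF s] by (simp add: mult_ac)
  qed
  also have "\<dots> = of_real (p $ k * (exp (- b * (norm p)\<^sup>2) / sqrt ((norm p)\<^sup>2 + m\<^sup>2)))"
    unfolding integral_complex_of_real integral_mult_right_zero integral_gaussian_energy[OF m] ..
  finally show ?thesis .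
qed

section \<open>Dirac matrices\<close>

lemma of_real_vec_smult: "complex_of_real r *s w = r *\<^sub>R w" for w :: "complex^'n"
  by (simp add: vec_eq_iff scaleR_conv_of_real[where 'a = complex])

lemma scaleR_matrix_vector: "(r *\<^sub>R A) *v w = r *\<^sub>R (A *v w)" for A :: "complex^'n^'m"
  by (simp add: vec_eq_iff matrix_vector_mult_def scaleR_sum_right)

lemma matrix_vector_scaleR: "A *v (r *\<^sub>R w) = r *\<^sub>R (A *v w)" for A :: "complex^'n^'m"
  by (simp add: vec_eq_iff matrix_vector_mult_def scaleR_sum_right)

lemma sum_matrix_vector: "(\<Sum>j\<in>I. A j) *v w = (\<Sum>j\<in>I. A j *v w)" for A :: "'i \<Rightarrow> complex^'n^'m"
  by (induction I rule: infinite_finite_induct) (auto simp: matrix_vector_mult_add_rdistrib)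

lemma inner_complex_vec: "x \<bullet> y = Re (\<Sum>i\<in>UNIV. cnj (x $ i) * y $ i)" for x y :: "complex^'n"
  by (simp add: inner_vec_def inner_complex_def)

lemma hermitian4_inner:
  assumes "hermitian4 A"
  shows "(A *v x) \<bullet> y = x \<bullet> (A *v y)"
proof -
  have A: "cnj (A $ i $ j) = A $ j $ i" for i j
    using assms unfolding hermitian4_def by (metis complex_cnj_cnj)
  have "(\<Sum>i\<in>UNIV. cnj ((A *v x) $ i) * y $ i) = (\<Sum>i\<in>UNIV. \<Sum>j\<in>UNIV. A $ j $ i * cnj (x $ j) * y $ i)"
    by (simp add: matrix_vector_mult_def A sum_distrib_right)
  also have "\<dots> = (\<Sum>i\<in>UNIV. cnj (x $ i) * (A *v y) $ i)"
    by (subst sum.swap) (simp add: matrix_vector_mult_def sum_distrib_left mult_ac)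
  finally show ?thesis by (simp add: inner_complex_vec)
qed

text \<open>For the real inner product, \<open>A\<close> is symmetric and multiplication by \<i> is
  antisymmetric. As the two commute, the expression equals its own negative.\<close>

lemma hermitian4_inner_imaginary:
  assumes "hermitian4 A"
  shows "v \<bullet> (\<i> *s (A *v v)) = 0"
proof -
  have i: "(\<i> *s x) \<bullet> y = - (x \<bullet> (\<i> *s y))" for x y :: "complex^4"
    by (simp add: inner_complex_vec sum_negf[symmetric] mult_ac)
  have "v \<bullet> (\<i> *s (A *v v)) = v \<bullet> (A *v (\<i> *s v))"
    by (simp add: vector_scalar_commute)
  also have "\<dots> = (\<i> *s v) \<bullet> (A *v v)"
    by (simp add: hermitian4_inner[OF assms, symmetric] inner_commute)
  also have "\<dots> = - (v \<bullet> (\<i> *s (A *v v)))" by (rule i)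
  finally show ?thesis by simp
qed

lemma dirac_matrices_square:
  assumes "dirac_matrices \<alpha> \<beta>"
  shows "\<alpha> j ** \<alpha> j = mat 1"
proof -
  have "\<alpha> j ** \<alpha> j + \<alpha> j ** \<alpha> j = 2 *\<^sub>R mat 1" using assms by (auto simp: dirac_matrices_def)
  then have "2 *\<^sub>R (\<alpha> j ** \<alpha> j) = 2 *\<^sub>R mat 1" by (simp only: scaleR_2)
  then show ?thesis by simp
qed

lemma matrix_add_rdistrib: "(A + B) ** C = A ** C + B ** C" for A B :: "complex^'n^'m"
  by (simp add: vec_eq_iff matrix_matrix_mult_def distrib_right sum.distrib)

text \<open>On expanding the square, the mixed products cancel by anticommutation and the diagonal
  ones give |p|^2 + m^2.\<close>

lemma dirac_symbol_square:
  assumes "dirac_matrices \<alpha> \<beta>"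
  shows "dirac_symbol \<alpha> \<beta> m p ** dirac_symbol \<alpha> \<beta> m p = ((norm p)\<^sup>2 + m\<^sup>2) *\<^sub>R mat 1"
proof -
  have sq: "\<alpha> j ** \<alpha> j = mat 1" "\<beta> ** \<beta> = mat 1" for j
    using assms dirac_matrices_square by (auto simp: dirac_matrices_def)
  have anti: "\<alpha> j ** \<alpha> k = - (\<alpha> k ** \<alpha> j)" if "j \<noteq> k" for j k
    using assms that by (auto simp: dirac_matrices_def eq_neg_iff_add_eq_0)
  have antib: "\<beta> ** \<alpha> j = - (\<alpha> j ** \<beta>)" for j
    using assms by (auto simp: dirac_matrices_def eq_neg_iff_add_eq_0 add.commute)
  have n: "(norm p)\<^sup>2 = (p $ 1)\<^sup>2 + (p $ 2)\<^sup>2 + (p $ 3)\<^sup>2"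
    by (simp add: norm_vec_def L2_set_def sum_nonneg sum_3)
  show ?thesis
    unfolding dirac_symbol_def sum_3 n
    \<comment> \<open>The anticommutation rules are oriented to sort every product, smaller index
      first and \<beta> last, so rewriting terminates and the mixed terms cancel.\<close>
    by (simp add: matrix_add_ldistrib matrix_add_rdistrib scalar_matrix_assoc[symmetric] matrix_scalar_ac sq antib
        anti[of 2 1] anti[of 3 1] anti[of 3 2] algebra_simps power2_eq_square)
qed

text \<open>The symmetric involution \<open>\<alpha> 1\<close> anticommutes with \<beta>, hence
  reverses the sign of the expectation of \<beta>. So either a basis vector \<open>u\<close> or its
  image \<open>w\<close> will do.\<close>

lemma dirac_positive_spinor:
  assumes D: "dirac_matrices \<alpha> \<beta>"
  obtains v where "norm v = 1" "0 \<le> v \<bullet> (\<beta> *v v)"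
proof -
  define u :: "complex^4" where "u = axis 1 1"
  have u: "u \<bullet> u = 1" by (simp add: u_def inner_axis_axis)
  define w where "w = \<alpha> 1 *v u"
  have h: "hermitian4 (\<alpha> 1)" and anti: "\<beta> ** \<alpha> 1 = - (\<alpha> 1 ** \<beta>)"
    using D by (auto simp: dirac_matrices_def eq_neg_iff_add_eq_0 add.commute)
  have a: "\<alpha> 1 *v (\<alpha> 1 *v x) = x" for x
    using dirac_matrices_square[OF D] by (simp add: matrix_vector_mul_assoc)
  have w: "w \<bullet> w = 1"
    unfolding w_def hermitian4_inner[OF h] a by (rule u)
  have "\<beta> *v w = - (\<alpha> 1 *v (\<beta> *v u))"
    unfolding w_def matrix_vector_mul_assoc anti by (simp add: vec_eq_iff matrix_vector_mult_def sum_negf)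
  then have "w \<bullet> (\<beta> *v w) = - (u \<bullet> (\<beta> *v u))"
    unfolding w_def by (simp add: hermitian4_inner[OF h] a)
  then have "0 \<le> u \<bullet> (\<beta> *v u) \<or> 0 \<le> w \<bullet> (\<beta> *v w)" by linarith
  then show ?thesis using that u w by (auto simp: norm_eq_1)
qed

section \<open>Localised positive-energy spinors\<close>

text \<open>This is the inverse Fourier transform of \<open>phi\<close>, written out summand by
  summand; the factor \<i> comes from differentiating in position space.\<close>

definition psi :: "(3 \<Rightarrow> complex^4^4) \<Rightarrow> complex^4^4 \<Rightarrow> real \<Rightarrow> real \<Rightarrow> complex^4 \<Rightarrow> real^3 \<Rightarrow> complex^4" where
  "psi \<alpha> \<beta> m b v x = heat b x *\<^sub>R v + (m * inv_energy m b x) *\<^sub>R (\<beta> *v v)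
     + (\<Sum>j\<in>UNIV. (x $ j * inv_energy_grad m b x) *\<^sub>R (\<i> *s (\<alpha> j *v v)))"

text \<open>A Gaussian cutoff times 1 + H/E, which is twice the spectral projection onto positive
  energy.\<close>

definition phi :: "(3 \<Rightarrow> complex^4^4) \<Rightarrow> complex^4^4 \<Rightarrow> real \<Rightarrow> real \<Rightarrow> complex^4 \<Rightarrow> real^3 \<Rightarrow> complex^4" where
  "phi \<alpha> \<beta> m b v p = exp (- b * (norm p)\<^sup>2) *\<^sub>R
     (v + (1 / sqrt ((norm p)\<^sup>2 + m\<^sup>2)) *\<^sub>R (dirac_symbol \<alpha> \<beta> m p *v v))"

definition spinor_bound :: "(3 \<Rightarrow> complex^4^4) \<Rightarrow> complex^4^4 \<Rightarrow> complex^4 \<Rightarrow> real" where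
  "spinor_bound \<alpha> \<beta> v = norm v + norm (\<beta> *v v) + (\<Sum>j\<in>UNIV. norm (\<alpha> j *v v))"

lemma spinor_bound_nonneg: "0 \<le> spinor_bound \<alpha> \<beta> v"
  by (simp add: spinor_bound_def sum_nonneg)

section \<open>Norm bounds and the second moment of the wave packet\<close>

lemma integrable_nonneg_bound:
  fixes f g :: "'a \<Rightarrow> real"
  assumes g: "integrable M g" and f: "f \<in> borel_measurable M" "\<And>x. 0 \<le> f x" "\<And>x. f x \<le> g x"
  shows "integrable M f"
proof (rule Bochner_Integration.integrable_bound[OF g f(1)], rule AE_I2)
  fix x
  have "norm (f x) = f x" using f(2) by simp
  also have "\<dots> \<le> norm (g x)" unfolding real_norm_def by (rule order_trans[OF f(3) abs_ge_self])
  finally show "norm (f x) \<le> norm (g x)" .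
qed

text \<open>Leaving \<open>w\<close> open lets one estimate cover both \<open>psi\<close>, where
  \<open>w j\<close> is \<open>\<i> *s (\<alpha> j *v v)\<close>, and \<open>phi\<close>, where it
  is \<open>\<alpha> j *v v\<close>.\<close>

lemma norm_spinor_combination_le:
  assumes c: "0 \<le> c" and w: "\<And>j. norm (w j) = norm (\<alpha> j *v v)"
  shows "norm (a *\<^sub>R v + d *\<^sub>R (\<beta> *v v) + (\<Sum>j\<in>UNIV. (x $ j * c) *\<^sub>R w j))
    \<le> spinor_bound \<alpha> \<beta> v * (\<bar>a\<bar> + \<bar>d\<bar> + norm x * c)"
proof -
  let ?S = "spinor_bound \<alpha> \<beta> v"
  have S: "norm v \<le> ?S" "norm (\<beta> *v v) \<le> ?S" "(\<Sum>j\<in>UNIV. norm (\<alpha> j *v v)) \<le> ?S"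
    by (simp_all add: spinor_bound_def sum_nonneg)
  have "norm (\<Sum>j\<in>UNIV. (x $ j * c) *\<^sub>R w j) \<le> (\<Sum>j\<in>UNIV. (norm x * c) * norm (\<alpha> j *v v))"
  proof (rule order_trans[OF norm_sum sum_mono])
    show "norm ((x $ j * c) *\<^sub>R w j) \<le> norm x * c * norm (\<alpha> j *v v)" for j
      using c component_le_norm_cart[of x j] by (simp add: w abs_mult mult_right_mono)
  qed
  also have "\<dots> \<le> (norm x * c) * ?S"
    unfolding sum_distrib_left[symmetric] by (rule mult_left_mono) (use S c in auto)
  finally have 3: "norm (\<Sum>j\<in>UNIV. (x $ j * c) *\<^sub>R w j) \<le> (norm x * c) * ?S" .
  have "norm (a *\<^sub>R v) \<le> \<bar>a\<bar> * ?S" "norm (d *\<^sub>R (\<beta> *v v)) \<le> \<bar>d\<bar> * ?S"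
    using S by (simp_all add: mult_left_mono)
  with 3 have "norm (a *\<^sub>R v + d *\<^sub>R (\<beta> *v v) + (\<Sum>j\<in>UNIV. (x $ j * c) *\<^sub>R w j))
      \<le> \<bar>a\<bar> * ?S + \<bar>d\<bar> * ?S + (norm x * c) * ?S"
    by (intro norm_triangle_le add_mono)
  then show ?thesis by (simp add: algebra_simps)
qed

lemma borel_measurable_psi [measurable]: "psi \<alpha> \<beta> m b v \<in> borel_measurable borel"
proof -
  have [measurable]: "(\<lambda>x::real^3. x $ k) \<in> borel_measurable borel" for k
    by (intro borel_measurable_continuous_onI continuous_intros)
  show ?thesis unfolding psi_def[abs_def] by measurable
qed

lemma norm_imaginary_smult: "norm (\<i> *s w) = norm w" for w :: "complex^'n"
  by (simp add: norm_vec_def norm_mult)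

lemma norm_psi_le:
  assumes b: "b > 0" and m: "m > 0"
  shows "norm (psi \<alpha> \<beta> m b v x)
    \<le> spinor_bound \<alpha> \<beta> v * (heat b x + m * inv_energy m b x + norm x * inv_energy_grad m b x)"
  unfolding psi_def
  using norm_spinor_combination_le[OF inv_energy_inv_energy_grad_bounds(2)[OF b m], of "\<lambda>j. \<i> *s (\<alpha> j *v v)" \<alpha> v
      "heat b x" "m * inv_energy m b x" \<beta> x x]
    inv_energy_inv_energy_grad_bounds(1)[OF b m, of x] heat_pos[OF b, of x] m
  by (simp add: norm_imaginary_smult)

text \<open>Taking the real inner product with \<open>v\<close> kills the terms \<open>\<i> \<alpha>\<^sub>j v\<close>, and the \<open>\<beta>\<close> term is nonnegative.\<close>

lemma norm_psi_ge:
  assumes b: "b > 0" and m: "m > 0" and D: "dirac_matrices \<alpha> \<beta>"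
    and v: "norm v = 1" "0 \<le> v \<bullet> (\<beta> *v v)"
  shows "heat b x \<le> norm (psi \<alpha> \<beta> m b v x)"
proof -
  have "v \<bullet> (\<i> *s (\<alpha> j *v v)) = 0" for j
    using D by (intro hermitian4_inner_imaginary) (simp add: dirac_matrices_def)
  then have "v \<bullet> psi \<alpha> \<beta> m b v x = heat b x + m * inv_energy m b x * (v \<bullet> (\<beta> *v v))"
    using v(1) by (simp add: psi_def inner_add_right inner_sum_right norm_eq_1)
  then have "heat b x \<le> v \<bullet> psi \<alpha> \<beta> m b v x"
    using v(2) m inv_energy_inv_energy_grad_bounds(1)[OF b m, of x] by simp
  also have "\<dots> \<le> norm v * norm (psi \<alpha> \<beta> m b v x)" by (rule norm_cauchy_schwarz)
  finally show ?thesis using v by simp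
qed

text \<open>The constant depends on b and degenerates as b tends to 0, which is harmless for
  integrability at fixed b.\<close>

lemma norm_psi_envelope:
  assumes b: "b > 0" and m: "m > 0"
  obtains c where "0 \<le> c" "\<And>x. norm (psi \<alpha> \<beta> m b v x) \<le> c * (wide_heat b x + envelope m b x)"
proof
  let ?S = "spinor_bound \<alpha> \<beta> v" and ?c = "1 + m + 1 / sqrt b"
  show "0 \<le> ?S * ?c" using b m by (simp add: spinor_bound_nonneg)
  show "norm (psi \<alpha> \<beta> m b v x) \<le> ?S * ?c * (wide_heat b x + envelope m b x)" for x
  proof -
    note bb = inv_energy_inv_energy_grad_bounds[OF b m, of x] and e = envelope_nonneg[OF b, of m x] and w = wide_heat_pos[OF b, of x]
    have "heat b x + m * inv_energy m b x + norm x * inv_energy_grad m b x \<le> wide_heat b x + m * envelope m b x + 1 / sqrt b * envelope m b x"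
      using heat_le_wide_heat(1)[OF b, of x] bb m by (intro add_mono mult_left_mono) auto
    also have "\<dots> \<le> ?c * (wide_heat b x + envelope m b x)"
      using e w m b by (simp add: algebra_simps)
    finally have "?S * (heat b x + m * inv_energy m b x + norm x * inv_energy_grad m b x) \<le> ?S * (?c * (wide_heat b x + envelope m b x))"
      by (rule mult_left_mono) (rule spinor_bound_nonneg)
    with norm_psi_le[OF b m, of \<alpha> \<beta> v x] show ?thesis by (simp add: mult.assoc)
  qed
qed

lemma square_add_le: "(a + b)\<^sup>2 \<le> 2 * (a\<^sup>2 + b\<^sup>2)" for a b :: real
  using zero_le_power2[of "a - b"] by (simp add: power2_eq_square algebra_simps)

lemma integrable_wide_heat_envelope_square:
  assumes b: "b > 0" and m: "m > 0"
  shows "integrable lborel (\<lambda>x. 2 * ((c * wide_heat b x)\<^sup>2 + (d * envelope m b x)\<^sup>2))"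
  using integral_wide_heat_square(1)[OF b] integral_envelope_square(1)[OF b m] by (simp add: power_mult_distrib)

lemma integrable_psi:
  assumes b: "b > 0" and m: "m > 0"
  shows "integrable lborel (psi \<alpha> \<beta> m b v)"
    and "integrable lborel (\<lambda>x. (norm (psi \<alpha> \<beta> m b v x))\<^sup>2)"
proof -
  obtain c where c: "0 \<le> c" "\<And>x. norm (psi \<alpha> \<beta> m b v x) \<le> c * (wide_heat b x + envelope m b x)"
    using norm_psi_envelope[OF b m] by blast
  have "integrable lborel (\<lambda>x. c * (wide_heat b x + envelope m b x))"
    using integral_wide_heat(1)[OF b] integrable_envelope[OF b m] by simp
  then show "integrable lborel (psi \<alpha> \<beta> m b v)"
    by (rule Bochner_Integration.integrable_bound) (auto intro!: AE_I2 order_trans[OF c(2) abs_ge_self])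
  show "integrable lborel (\<lambda>x. (norm (psi \<alpha> \<beta> m b v x))\<^sup>2)"
  proof (rule integrable_nonneg_bound[OF integrable_wide_heat_envelope_square[OF b m, of c c]])
    show "(norm (psi \<alpha> \<beta> m b v x))\<^sup>2 \<le> 2 * ((c * wide_heat b x)\<^sup>2 + (c * envelope m b x)\<^sup>2)" for x
      using order_trans[OF power_mono[OF c(2) norm_ge_zero] square_add_le[of "c * wide_heat b x" "c * envelope m b x", folded distrib_left]]
      by simp
  qed auto
qed

text \<open>After multiplication by |x|, the \<open>heat\<close> term is at most
  \<open>sqrt b * wide_heat b x\<close> and the two inverse-energy terms are at most fixed multiples
  of the envelope. The squares of both have integrals of order at most 1 / b, with constants
  independent of b.\<close>

lemma second_moment_psi:
  fixes \<alpha> :: "3 \<Rightarrow> complex^4^4" and \<beta> :: "complex^4^4"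
  assumes m: "m > 0"
  obtains R where "0 \<le> R" and "\<And>b. 0 < b \<Longrightarrow> b \<le> 1 \<Longrightarrow>
      integrable lborel (\<lambda>x. (norm x)\<^sup>2 * (norm (psi \<alpha> \<beta> m b v x))\<^sup>2) \<and>
      (\<integral>x. (norm x)\<^sup>2 * (norm (psi \<alpha> \<beta> m b v x))\<^sup>2 \<partial>lborel) \<le> R / b"
proof
  let ?S = "spinor_bound \<alpha> \<beta> v"
  \<comment> \<open>\<open>Q\<close> collects the coefficients of the envelope:
    \<open>m * (1 + 2 / m\<^sup>2)\<close> from \<open>inv_energy\<close> and 4 from
    \<open>inv_energy_grad\<close>.\<close>
  define Q where "Q = m * (1 + 2 / m\<^sup>2) + 4"
  define c4 where "c4 = sqrt (4 * pi) ^ 3"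
  define c5 where "c5 = pi * sqrt (4 * pi) ^ 3 * sqrt (pi / m\<^sup>2)"
  let ?R = "2 * ?S\<^sup>2 * (c4 + Q\<^sup>2 * c5)"
  have c: "0 \<le> c4" "0 \<le> c5" unfolding c4_def c5_def by simp_all
  then show "0 \<le> ?R" by simp
  fix b :: real assume b: "0 < b" and b1: "b \<le> 1"
  let ?g = "\<lambda>x. 2 * ((?S * sqrt b * wide_heat b x)\<^sup>2 + (?S * Q * envelope m b x)\<^sup>2)"
  have bound: "(norm x)\<^sup>2 * (norm (psi \<alpha> \<beta> m b v x))\<^sup>2 \<le> ?g x" for x
  proof -
    note bb = inv_energy_inv_energy_grad_bounds[OF b m, of x]
    have "norm x * (heat b x + m * inv_energy m b x + norm x * inv_energy_grad m b x)
        = norm x * heat b x + m * (norm x * inv_energy m b x) + (norm x)\<^sup>2 * inv_energy_grad m b x"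
      by (simp add: algebra_simps power2_eq_square)
    also have "\<dots> \<le> sqrt b * wide_heat b x + m * ((1 + 2 / m\<^sup>2) * envelope m b x) + 4 * envelope m b x"
      using heat_le_wide_heat(2)[OF b, of x] bb(4)[OF b1] bb(6) m by (intro add_mono mult_left_mono) auto
    also have "\<dots> = sqrt b * wide_heat b x + Q * envelope m b x"
      by (simp add: Q_def algebra_simps)
    finally have "?S * (norm x * (heat b x + m * inv_energy m b x + norm x * inv_energy_grad m b x)) \<le> ?S * (sqrt b * wide_heat b x + Q * envelope m b x)"
      by (rule mult_left_mono) (rule spinor_bound_nonneg)
    moreover have "norm x * norm (psi \<alpha> \<beta> m b v x) \<le> norm x * (?S * (heat b x + m * inv_energy m b x + norm x * inv_energy_grad m b x))"
      by (intro mult_left_mono norm_psi_le[OF b m]) simp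
    ultimately have "norm x * norm (psi \<alpha> \<beta> m b v x) \<le> ?S * sqrt b * wide_heat b x + ?S * Q * envelope m b x"
      by (simp add: algebra_simps)
    then have "(norm x * norm (psi \<alpha> \<beta> m b v x))\<^sup>2 \<le> (?S * sqrt b * wide_heat b x + ?S * Q * envelope m b x)\<^sup>2"
      by (rule power_mono) simp
    also have "\<dots> \<le> ?g x" by (rule square_add_le)
    finally show ?thesis by (simp add: power_mult_distrib)
  qed
  have ig: "integrable lborel ?g" by (rule integrable_wide_heat_envelope_square[OF b m])
  have i: "integrable lborel (\<lambda>x. (norm x)\<^sup>2 * (norm (psi \<alpha> \<beta> m b v x))\<^sup>2)"
    by (rule integrable_nonneg_bound[OF ig _ _ bound]) auto
  have "(\<integral>x. (norm x)\<^sup>2 * (norm (psi \<alpha> \<beta> m b v x))\<^sup>2 \<partial>lborel) \<le> integral\<^sup>L lborel ?g"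
    by (rule integral_mono[OF i ig bound])
  also have "\<dots> = 2 * (?S\<^sup>2 * (b * (\<integral>x. (wide_heat b x)\<^sup>2 \<partial>lborel)) + ?S\<^sup>2 * (Q\<^sup>2 * (\<integral>x. (envelope m b x)\<^sup>2 \<partial>lborel)))"
    using b integral_wide_heat_square(1)[OF b] integral_envelope_square(1)[OF b m] by (simp add: power_mult_distrib)
  also have "\<dots> \<le> 2 * (?S\<^sup>2 * (c4 / b) + ?S\<^sup>2 * (Q\<^sup>2 * (c5 / b)))"
  proof (intro mult_left_mono add_mono)
    have "b * (\<integral>x. (wide_heat b x)\<^sup>2 \<partial>lborel) = c4 / sqrt b"
      unfolding integral_wide_heat_square(2)[OF b] c4_def
      using square_times_divide_cube[of "sqrt b" "sqrt (4 * pi) ^ 3"] b by simp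
    \<comment> \<open>The Gaussian part is only of order 1 / sqrt b; b \<le> 1 allows it to be
      merged with the envelope part.\<close>
    also have "\<dots> \<le> c4 / b"
    proof (rule divide_left_mono)
      show "b \<le> sqrt b" using b b1 by (intro real_le_rsqrt) (simp add: power2_eq_square mult_le_cancel_left1)
    qed (use b c in auto)
    finally show "b * (\<integral>x. (wide_heat b x)\<^sup>2 \<partial>lborel) \<le> c4 / b" .
    show "(\<integral>x. (envelope m b x)\<^sup>2 \<partial>lborel) \<le> c5 / b"
      using integral_envelope_square(2)[OF b m] by (simp only: c5_def)
  qed auto
  also have "\<dots> = ?R / b" by (simp add: add_divide_distrib algebra_simps)
  finally show "integrable lborel (\<lambda>x. (norm x)\<^sup>2 * (norm (psi \<alpha> \<beta> m b v x))\<^sup>2) \<and>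
      (\<integral>x. (norm x)\<^sup>2 * (norm (psi \<alpha> \<beta> m b v x))\<^sup>2 \<partial>lborel) \<le> ?R / b"
    using i by blast
qed

section \<open>Fourier transform and positive energy of the wave packet\<close>

lemma phi_expand:
  "phi \<alpha> \<beta> m b v p = exp (- b * (norm p)\<^sup>2) *\<^sub>R v
     + (m * (exp (- b * (norm p)\<^sup>2) / sqrt ((norm p)\<^sup>2 + m\<^sup>2))) *\<^sub>R (\<beta> *v v)
     + (\<Sum>j\<in>UNIV. (p $ j * (exp (- b * (norm p)\<^sup>2) / sqrt ((norm p)\<^sup>2 + m\<^sup>2))) *\<^sub>R (\<alpha> j *v v))"
proof -
  have "dirac_symbol \<alpha> \<beta> m p *v v = (\<Sum>j\<in>UNIV. p $ j *\<^sub>R (\<alpha> j *v v)) + m *\<^sub>R (\<beta> *v v)"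
    by (simp add: dirac_symbol_def matrix_vector_mult_add_rdistrib sum_matrix_vector scaleR_matrix_vector)
  then show ?thesis
    by (simp add: phi_def scaleR_add_right scaleR_sum_right mult_ac)
qed

lemma fourier3_psi:
  assumes b: "b > 0" and m: "m > 0"
  shows "fourier3 (\<lambda>x. psi \<alpha> \<beta> m b v x $ k) p = phi \<alpha> \<beta> m b v p $ k"
proof -
  have [measurable]: "(\<lambda>x::real^3. x $ j) \<in> borel_measurable borel" for j
    by (intro borel_measurable_continuous_onI continuous_intros)
  note bb = inv_energy_inv_energy_grad_bounds[OF b m]
  define A where "A x = complex_of_real (heat b x) * v $ k" for x
  define B where "B x = complex_of_real (inv_energy m b x) * (of_real m * (\<beta> *v v) $ k)" for x
  define C where "C j x = (\<i> * complex_of_real (x $ j * inv_energy_grad m b x)) * (\<alpha> j *v v) $ k" for j x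
  have psi: "psi \<alpha> \<beta> m b v x $ k = (A x + B x) + (\<Sum>j\<in>UNIV. C j x)" for x
    by (simp add: psi_def A_def B_def C_def scaleR_conv_of_real[where 'a = complex] mult_ac)
  have iA: "integrable lborel A"
    unfolding A_def
    by (intro integrable_mult_left integrable_of_real
        integrable_nonneg_bound[OF integral_wide_heat(1)[OF b] _ _ heat_le_wide_heat(1)[OF b]])
       (auto intro: less_imp_le[OF heat_pos[OF b]])
  have iB: "integrable lborel B"
    unfolding B_def
    by (intro integrable_mult_left integrable_of_real
        integrable_nonneg_bound[OF integrable_envelope[OF b m] _ bb(1) bb(3)]) measurable
  have iC: "integrable lborel (C j)" for j
    unfolding C_def
  proof (intro integrable_mult_left integrable_mult_right integrable_of_real)
    have "integrable lborel (\<lambda>x. 1 / sqrt b * envelope m b x)" using integrable_envelope[OF b m] by simp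
    then show "integrable lborel (\<lambda>x. x $ j * inv_energy_grad m b x)"
    proof (rule Bochner_Integration.integrable_bound, measurable, intro AE_I2)
      fix x :: "real^3"
      have "norm (x $ j * inv_energy_grad m b x) \<le> norm x * inv_energy_grad m b x"
        using bb(2)[of x] component_le_norm_cart[of x j] by (simp add: abs_mult mult_right_mono)
      also have "\<dots> \<le> 1 / sqrt b * envelope m b x" by (rule bb(5))
      also have "\<dots> \<le> norm (1 / sqrt b * envelope m b x)" unfolding real_norm_def by (rule abs_ge_self)
      finally show "norm (x $ j * inv_energy_grad m b x) \<le> norm (1 / sqrt b * envelope m b x)" .
    qed
  qed
  have "fourier3 (\<lambda>x. psi \<alpha> \<beta> m b v x $ k) p = fourier3 A p + fourier3 B p + (\<Sum>j\<in>UNIV. fourier3 (C j) p)"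
    unfolding psi using iA iB iC
    by (simp only: fourier3_add[OF Bochner_Integration.integrable_add[OF iA iB] Bochner_Integration.integrable_sum[OF iC]]
        fourier3_add[OF iA iB] fourier3_sum[OF iC])
  also have "\<dots> = phi \<alpha> \<beta> m b v p $ k"
    unfolding A_def[abs_def] B_def[abs_def] C_def[abs_def] fourier3_mult_right
      fourier3_heat[OF b] fourier3_inv_energy[OF b m] fourier3_inv_energy_grad[OF b m] phi_expand
    by (simp add: scaleR_conv_of_real[where 'a = complex] mult_ac)
  finally show ?thesis .
qed

text \<open>Both m and |p| are at most E, so each of the three groups of terms in the expansion is
  bounded by \<open>spinor_bound\<close> times the Gaussian cutoff; this accounts for the factor
  3.\<close>

lemma L2_phi:
  assumes b: "b > 0" and m: "m > 0"
  shows "L2 (phi \<alpha> \<beta> m b v)"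
proof -
  let ?S = "spinor_bound \<alpha> \<beta> v"
  have [measurable]: "(\<lambda>x::real^3. x $ j) \<in> borel_measurable borel" for j
    by (intro borel_measurable_continuous_onI continuous_intros)
  have meas [measurable]: "phi \<alpha> \<beta> m b v \<in> borel_measurable borel"
    unfolding phi_expand[abs_def] by measurable
  have bound: "(norm (phi \<alpha> \<beta> m b v p))\<^sup>2 \<le> (3 * ?S)\<^sup>2 * exp (- (2 * b) * (norm p)\<^sup>2)" for p
  proof -
    let ?e = "exp (- b * (norm p)\<^sup>2)" and ?E = "sqrt ((norm p)\<^sup>2 + m\<^sup>2)"
    have "0 < (norm p)\<^sup>2 + m\<^sup>2" using m by (simp add: add_nonneg_pos)
    then have E: "0 < ?E" "m \<le> ?E" "norm p \<le> ?E" using m by (auto intro!: real_le_rsqrt)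
    have "norm (phi \<alpha> \<beta> m b v p) \<le> ?S * (\<bar>?e\<bar> + \<bar>m * (?e / ?E)\<bar> + norm p * (?e / ?E))"
      unfolding phi_expand by (rule norm_spinor_combination_le) (use E in auto)
    also have "\<dots> \<le> ?S * (?e + 1 * ?e + 1 * ?e)"
    proof (intro mult_left_mono add_mono spinor_bound_nonneg)
      show "\<bar>m * (?e / ?E)\<bar> \<le> 1 * ?e" "norm p * (?e / ?E) \<le> 1 * ?e"
        using E m by (simp_all add: abs_mult field_simps)
    qed simp
    also have "\<dots> = 3 * ?S * ?e" by simp
    finally have "(norm (phi \<alpha> \<beta> m b v p))\<^sup>2 \<le> (3 * ?S * ?e)\<^sup>2"
      by (rule power_mono) simp
    also have "\<dots> = (3 * ?S)\<^sup>2 * exp (- (2 * b) * (norm p)\<^sup>2)"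
      by (simp add: power_mult_distrib flip: exp_double)
    finally show ?thesis .
  qed
  have "integrable lborel (\<lambda>p::real^3. (3 * ?S)\<^sup>2 * exp (- (2 * b) * (norm p)\<^sup>2))"
    using integral_gaussian_vec(1)[where c = "2 * b" and 'n = 3] b by simp
  then have "integrable lborel (\<lambda>p. (norm (phi \<alpha> \<beta> m b v p))\<^sup>2)"
    by (rule integrable_nonneg_bound[OF _ _ _ bound]) auto
  with meas show ?thesis by (simp add: L2_def)
qed

text \<open>Since H^2 = E^2, one has H (1 + H/E) v = H v + E v = E (1 + H/E) v.\<close>

lemma dirac_symbol_phi:
  assumes D: "dirac_matrices \<alpha> \<beta>" and m: "m > 0"
  shows "dirac_symbol \<alpha> \<beta> m p *v phi \<alpha> \<beta> m b v p = of_real (sqrt ((norm p)\<^sup>2 + m\<^sup>2)) *s phi \<alpha> \<beta> m b v p"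
proof -
  let ?H = "dirac_symbol \<alpha> \<beta> m p" and ?E = "sqrt ((norm p)\<^sup>2 + m\<^sup>2)"
  have "0 < (norm p)\<^sup>2 + m\<^sup>2" using m by (simp add: add_nonneg_pos)
  then have E: "?E \<noteq> 0" "?E\<^sup>2 = (norm p)\<^sup>2 + m\<^sup>2" by auto
  have "?H *v (?H *v v) = ?E\<^sup>2 *\<^sub>R v"
    unfolding matrix_vector_mul_assoc dirac_symbol_square[OF D] E(2) scaleR_matrix_vector by simp
  then show ?thesis
    using E(1) unfolding of_real_vec_smult phi_def
    by (simp add: matrix_vector_scaleR matrix_vector_right_distrib scaleR_add_right power2_eq_square
        del: real_sqrt_mult_self)
qed

lemma integrable_compact_support:
  fixes g :: "'a::euclidean_space \<Rightarrow> complex"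
  assumes g: "continuous_on UNIV g" and bd: "bounded {p. g p \<noteq> 0}"
  shows "integrable lborel g"
proof -
  obtain r where r: "{p. g p \<noteq> 0} \<subseteq> cball 0 r"
    using bd by (auto simp: bounded_iff subset_iff)
  have "integrable lborel (\<lambda>p. indicator (cball 0 r) p *\<^sub>R g p)"
    by (rule borel_integrable_compact) (auto intro: continuous_on_subset[OF g])
  also have "(\<lambda>p. indicator (cball 0 r) p *\<^sub>R g p) = g"
    using r by (auto simp: fun_eq_iff indicator_def)
  finally show ?thesis .
qed

text \<open>As \<open>psi\<close> is integrable with ordinary transform \<open>phi\<close>, the
  defining identity is \<open>integral_fourier3_mult\<close> in each component; compact support
  makes the test function integrable.\<close>

lemma is_fourier_L2_psi:
  assumes b: "b > 0" and m: "m > 0"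
  shows "is_fourier_L2 (psi \<alpha> \<beta> m b v) (phi \<alpha> \<beta> m b v)"
  unfolding is_fourier_L2_def
proof (intro conjI allI impI L2_phi[OF b m])
  show "L2 (psi \<alpha> \<beta> m b v)"
    using integrable_psi(2)[OF b m] by (simp add: L2_def)
  fix g :: "real^3 \<Rightarrow> complex" and k
  assume g: "continuous_on UNIV g" "bounded {p. g p \<noteq> 0}"
  have "integrable lborel (\<lambda>x. psi \<alpha> \<beta> m b v x $ k)"
    by (rule integrable_bounded_linear[OF bounded_linear_vec_nth integrable_psi(1)[OF b m]])
  from integral_fourier3_mult[OF this integrable_compact_support[OF g]]
  show "(\<integral>p. phi \<alpha> \<beta> m b v p $ k * g p \<partial>lborel) = (\<integral>x. psi \<alpha> \<beta> m b v x $ k * fourier3 g x \<partial>lborel)"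
    by (simp only: fourier3_psi[OF b m])
qed

section \<open>Normalisation and small uncertainty\<close>

lemma Hplus_scaleR:
  assumes "\<psi> \<in> Hplus \<alpha> \<beta> m"
  shows "(\<lambda>x. c *\<^sub>R \<psi> x) \<in> Hplus \<alpha> \<beta> m"
proof -
  obtain \<phi> where F: "is_fourier_L2 \<psi> \<phi>" and E: "AE p in lborel. dirac_symbol \<alpha> \<beta> m p *v \<phi> p =
        complex_of_real (sqrt ((norm p)\<^sup>2 + m\<^sup>2)) *s \<phi> p"
    using assms by (auto simp: Hplus_def)
  have L: "L2 f \<Longrightarrow> L2 (\<lambda>x. c *\<^sub>R f x)" for f
    by (auto simp: L2_def power_mult_distrib)
  have "is_fourier_L2 (\<lambda>x. c *\<^sub>R \<psi> x) (\<lambda>p. c *\<^sub>R \<phi> p)"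
    using F L unfolding is_fourier_L2_def
    by (simp add: scaleR_conv_of_real[where 'a = complex] mult.assoc)
  moreover have "AE p in lborel. dirac_symbol \<alpha> \<beta> m p *v (c *\<^sub>R \<phi> p) =
        complex_of_real (sqrt ((norm p)\<^sup>2 + m\<^sup>2)) *s (c *\<^sub>R \<phi> p)"
    using E by eventually_elim (simp add: matrix_vector_scaleR of_real_vec_smult scaleR_left_commute)
  ultimately show ?thesis unfolding Hplus_def by blast
qed

text \<open>Not automatic from the definition: \<^const>\<open>sqrt\<close> is odd, hence negative on negative reals.\<close>

lemma pos_uncertainty_nonneg:
  assumes L: "L2 \<psi>" and N: "L2norm_sq \<psi> = 1" and F: "finite_second_moment \<psi>"
  shows "0 \<le> pos_uncertainty \<psi>"
proof -
  let ?r = "\<lambda>x. (norm (\<psi> x))\<^sup>2"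
  define \<mu> where "\<mu> = (\<integral>x. ?r x *\<^sub>R x \<partial>lborel)"
  have [measurable]: "\<psi> \<in> borel_measurable borel" using L by (simp add: L2_def)
  have i0: "integrable lborel ?r" and i2: "integrable lborel (\<lambda>x. (norm x)\<^sup>2 * ?r x)"
    using L F by (simp_all add: L2_def finite_second_moment_def)
  have i1: "integrable lborel (\<lambda>x. ?r x *\<^sub>R x)"
  proof (rule Bochner_Integration.integrable_bound[OF Bochner_Integration.integrable_add[OF i0 i2]])
    show "AE x in lborel. norm (?r x *\<^sub>R x) \<le> norm (?r x + (norm x)\<^sup>2 * ?r x)"
    proof (rule AE_I2)
      fix x
      have "?r x * norm x \<le> ?r x * (1 + (norm x)\<^sup>2)"
        using abs_le_one_plus_square[of "norm x"] by (intro mult_left_mono) auto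
      then show "norm (?r x *\<^sub>R x) \<le> norm (?r x + (norm x)\<^sup>2 * ?r x)"
        by (simp add: algebra_simps)
    qed
  qed measurable
  \<comment> \<open>The second moment about the mean is nonnegative; expanding it with total mass 1
    yields the radicand of \<open>pos_uncertainty\<close>.\<close>
  have "0 \<le> (\<integral>x. ?r x * (norm (x - \<mu>))\<^sup>2 \<partial>lborel)"
    by (intro integral_nonneg_AE) simp
  also have "(\<lambda>x. ?r x * (norm (x - \<mu>))\<^sup>2) = (\<lambda>x. (norm x)\<^sup>2 * ?r x - 2 * ((?r x *\<^sub>R x) \<bullet> \<mu>) + (norm \<mu>)\<^sup>2 * ?r x)"
    by (simp add: fun_eq_iff power2_norm_eq_inner inner_diff_left inner_diff_right inner_commute algebra_simps)
  also have "(\<integral>x. (norm x)\<^sup>2 * ?r x - 2 * ((?r x *\<^sub>R x) \<bullet> \<mu>) + (norm \<mu>)\<^sup>2 * ?r x \<partial>lborel)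
      = (\<integral>x. (norm x)\<^sup>2 * ?r x \<partial>lborel) - 2 * (\<mu> \<bullet> \<mu>) + (norm \<mu>)\<^sup>2 * integral\<^sup>L lborel ?r"
    using i0 i1 i2 by (simp add: integral_inner_left[OF i1] \<mu>_def del: inner_scaleR_left)
  also have "\<dots> = (\<integral>x. (norm x)\<^sup>2 * ?r x \<partial>lborel) - (norm \<mu>)\<^sup>2"
    using N by (simp add: L2norm_sq_def power2_norm_eq_inner)
  finally show ?thesis unfolding pos_uncertainty_def \<mu>_def by simp
qed

text \<open>With b = r^2 the squared norm is at least 1 / r^3 and the second moment at most R / r^2.
  After normalisation the second moment is therefore at most R r, which is small with r.\<close>

lemma Hplus_small_uncertainty:
  assumes m: "m > 0" and D: "dirac_matrices \<alpha> \<beta>" and \<epsilon>: "\<epsilon> > 0"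
  shows "\<exists>\<psi>\<in>Hplus \<alpha> \<beta> m. L2norm_sq \<psi> = 1 \<and> finite_second_moment \<psi> \<and>
    0 \<le> pos_uncertainty \<psi> \<and> pos_uncertainty \<psi> < \<epsilon>"
proof -
  obtain v where v: "norm v = 1" "0 \<le> v \<bullet> (\<beta> *v v)"
    using dirac_positive_spinor[OF D] .
  obtain R where R: "0 \<le> R" "\<And>b. 0 < b \<Longrightarrow> b \<le> 1 \<Longrightarrow>
      integrable lborel (\<lambda>x. (norm x)\<^sup>2 * (norm (psi \<alpha> \<beta> m b v x))\<^sup>2) \<and>
      (\<integral>x. (norm x)\<^sup>2 * (norm (psi \<alpha> \<beta> m b v x))\<^sup>2 \<partial>lborel) \<le> R / b"
    using second_moment_psi[OF m] by blast
  \<comment> \<open>The bound by 1 ensures b \<le> 1. Dividing by \<open>R + 1\<close> avoids a zero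
    denominator and makes \<open>R * r\<close> strictly less than
    \<open>\<epsilon>\<^sup>2\<close>.\<close>
  define r where "r = min 1 (\<epsilon>\<^sup>2 / (R + 1))"
  have r: "0 < r" "r \<le> 1" "r \<le> \<epsilon>\<^sup>2 / (R + 1)" using \<epsilon> R(1) by (auto simp: r_def)
  define b where "b = r\<^sup>2"
  have b: "0 < b" "b \<le> 1" "sqrt b = r" using r by (auto simp: b_def power_le_one)
  let ?\<psi> = "psi \<alpha> \<beta> m b v"
  define N where "N = (\<integral>x. (norm (?\<psi> x))\<^sup>2 \<partial>lborel)"
  have "1 / r ^ 3 \<le> (\<integral>x. (heat b x)\<^sup>2 \<partial>lborel)"
    using integral_heat_square(2)[OF b(1)] unfolding b(3) .
  also have "\<dots> \<le> N"
    unfolding N_def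
  proof (rule integral_mono[OF integral_heat_square(1)[OF b(1)] integrable_psi(2)[OF b(1) m]])
    show "(heat b x)\<^sup>2 \<le> (norm (?\<psi> x))\<^sup>2" for x
      by (intro power_mono norm_psi_ge[OF b(1) m D v] less_imp_le[OF heat_pos[OF b(1)]])
  qed
  finally have N: "1 / r ^ 3 \<le> N" .
  moreover have "0 < 1 / r ^ 3" using r by simp
  ultimately have N0: "0 < N" by linarith
  define \<xi> where "\<xi> x = (1 / sqrt N) *\<^sub>R ?\<psi> x" for x
  have n\<xi>: "(norm (\<xi> x))\<^sup>2 = (norm (?\<psi> x))\<^sup>2 / N" for x
    using N0 by (simp add: \<xi>_def power_divide)
  have "?\<psi> \<in> Hplus \<alpha> \<beta> m"
    unfolding Hplus_def using is_fourier_L2_psi[OF b(1) m] dirac_symbol_phi[OF D m] by blast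
  then have H: "\<xi> \<in> Hplus \<alpha> \<beta> m"
    unfolding \<xi>_def[abs_def] by (rule Hplus_scaleR)
  have n: "L2norm_sq \<xi> = 1"
    unfolding L2norm_sq_def n\<xi> using N0 by (simp add: N_def)
  have f: "finite_second_moment \<xi>"
    unfolding finite_second_moment_def n\<xi> using R(2)[OF b(1,2)] by simp
  have "L2 \<xi>" using H by (auto simp: Hplus_def is_fourier_L2_def)
  from pos_uncertainty_nonneg[OF this n f] have p: "0 \<le> pos_uncertainty \<xi>" .
  have "(\<integral>x. (norm x)\<^sup>2 * (norm (\<xi> x))\<^sup>2 \<partial>lborel) = (\<integral>x. (norm x)\<^sup>2 * (norm (?\<psi> x))\<^sup>2 \<partial>lborel) / N"
    unfolding n\<xi> by simp
  also have "\<dots> \<le> (R / b) / (1 / r ^ 3)"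
    using R(1) R(2)[OF b(1,2)] N r b(1) by (intro frac_le) auto
  also have "\<dots> = R * r" using r by (simp add: b_def power2_eq_square power3_eq_cube)
  also have "\<dots> < (R + 1) * r" using r by simp
  also have "\<dots> \<le> \<epsilon>\<^sup>2" using r R(1) by (simp add: pos_le_divide_eq mult.commute)
  finally have "(\<integral>x. (norm x)\<^sup>2 * (norm (\<xi> x))\<^sup>2 \<partial>lborel) < \<epsilon>\<^sup>2" .
  \<comment> \<open>The squared mean is only subtracted, so the second moment about the origin
    already bounds the variance.\<close>
  then have "(\<integral>x. (norm x)\<^sup>2 * (norm (\<xi> x))\<^sup>2 \<partial>lborel)
      - (norm (\<integral>x. (norm (\<xi> x))\<^sup>2 *\<^sub>R x \<partial>lborel))\<^sup>2 < \<epsilon>\<^sup>2"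
    using zero_le_power2[of "norm (\<integral>x. (norm (\<xi> x))\<^sup>2 *\<^sub>R x \<partial>lborel)"] by linarith
  then have "pos_uncertainty \<xi> < \<epsilon>"
    unfolding pos_uncertainty_def using \<epsilon> real_sqrt_less_mono real_sqrt_abs by fastforce
  with H n f p show ?thesis by blast
qed

theorem theorem1:
  fixes \<alpha> :: "3 \<Rightarrow> complex^4^4" and \<beta> :: "complex^4^4" and m :: real
  assumes "m > 0" and "dirac_matrices \<alpha> \<beta>"
  shows "(\<forall>\<epsilon>>0. \<exists>\<psi>. \<psi> \<in> Hplus \<alpha> \<beta> m \<and> L2norm_sq \<psi> = 1 \<and> finite_second_moment \<psi> \<and>
            pos_uncertainty \<psi> < \<epsilon>)
       \<and> (\<exists>\<psi>s :: nat \<Rightarrow> real^3 \<Rightarrow> complex^4.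
            (\<forall>n. \<psi>s n \<in> Hplus \<alpha> \<beta> m \<and> L2norm_sq (\<psi>s n) = 1 \<and> finite_second_moment (\<psi>s n)) \<and>
            (\<lambda>n. pos_uncertainty (\<psi>s n)) \<longlonglongrightarrow> 0)"
proof
  note small = Hplus_small_uncertainty[OF assms]
  show "\<forall>\<epsilon>>0. \<exists>\<psi>. \<psi> \<in> Hplus \<alpha> \<beta> m \<and> L2norm_sq \<psi> = 1 \<and> finite_second_moment \<psi> \<and>
      pos_uncertainty \<psi> < \<epsilon>"
    using small by blast
  \<comment> \<open>Nonnegativity is carried along because the limit is obtained by squeezing
    between 0 and \<open>inverse (real (Suc n))\<close>, which is positive also for n = 0.\<close>
  have "\<forall>n. \<exists>\<psi>. \<psi> \<in> Hplus \<alpha> \<beta> m \<and> L2norm_sq \<psi> = 1 \<and> finite_second_moment \<psi> \<and>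
      0 \<le> pos_uncertainty \<psi> \<and> pos_uncertainty \<psi> < inverse (real (Suc n))"
    using small by (metis inverse_positive_iff_positive of_nat_0_less_iff zero_less_Suc)
  then obtain \<psi>s where \<psi>s: "\<And>n. \<psi>s n \<in> Hplus \<alpha> \<beta> m \<and> L2norm_sq (\<psi>s n) = 1 \<and> finite_second_moment (\<psi>s n) \<and>
      0 \<le> pos_uncertainty (\<psi>s n) \<and> pos_uncertainty (\<psi>s n) < inverse (real (Suc n))"
    by metis
  have "(\<lambda>n. pos_uncertainty (\<psi>s n)) \<longlonglongrightarrow> 0"
    by (rule tendsto_sandwich[OF _ _ tendsto_const LIMSEQ_inverse_real_of_nat])
       (use \<psi>s in \<open>auto intro!: always_eventually less_imp_le\<close>)
  with \<psi>s show "\<exists>\<psi>s :: nat \<Rightarrow> real^3 \<Rightarrow> complex^4.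
            (\<forall>n. \<psi>s n \<in> Hplus \<alpha> \<beta> m \<and> L2norm_sq (\<psi>s n) = 1 \<and> finite_second_moment (\<psi>s n)) \<and>
            (\<lambda>n. pos_uncertainty (\<psi>s n)) \<longlonglongrightarrow> 0"
    by blast
qed

end
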